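(* Let $\nu,s,t\ge1$ be fixed integers, let $\{d_n\}_n$ be a positive integer sequence tending to $\infty$, and, for every $n$, let $(n_1,\ldots,n_\nu)=(n_1(n),\ldots,n_\nu(n))$ be a partition of $d_n$. Let $\kappa:[0,1]\times[-\pi,\pi]\to\mathbb C^{s\times t}$ be measurable and let $\{A_n\}_n$ be a sequence of matrices with $A_n$ of size $d_ns\times d_nt$ and $\{A_n\}_n\sim_{\rm GLT}\kappa$. Then $$\Bigl\{\mathop{\rm blockdiag}_{n_1,\ldots,n_\nu}^{s,t}(A_n)\Bigr\}_n\sim_{\rm GLT}\kappa.$$
   Context: Conventions. A sequence of matrices is a sequence $\{A_n\}_n$, where $n$ varies in some infinite subset of $\mathbb N$ and $A_n$ is a complex matrix whose two dimensions both tend to $\infty$ as $n\to\infty$. All measure-theoretic terminology refers to Lebesgue measure; a matrix-valued function is measurable (continuous a.e., in $L^1$, etc.) if all its components are. $\|\cdot\|$ is the operator norm induced by the Euclidean norm, $x\wedge y=\min(x,y)$, and $I_s$ is the $s\times s$ identity matrix. A partition of a positive integer $m$ is a vector of positive integers $(m_1,\ldots,m_\nu)$ with $m_1+\cdots+m_\nu=m$. Block Jacobi preconditioner. Let $A=[A_{ij}]_{i,j=1}^m\in\mathbb C^{ms\times mt}$ with blocks $A_{ij}\in\mathbb C^{s\times t}$ and let $(m_1,\ldots,m_\nu)$ be a partition of $m$. Then $\mathop{\rm blockdiag}_{m_1,\ldots,m_\nu}^{s,t}(A)$ is the $ms\times mt$ block diagonal matrix with diagonal blocks $A^{(11)},\ldots,A^{(\nu\nu)}$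 (in this order), where $A^{(kk)}=[A_{ij}]_{i,j=m_1+\cdots+m_{k-1}+1}^{m_1+\cdots+m_k}$ has size $m_ks\times m_kt$; all other entries are zero. Toeplitz and diagonal sampling matrices. For $f:[-\pi,\pi]\to\mathbb C^{s\times t}$ in $L^1([-\pi,\pi])$, let $f_k=\frac1{2\pi}\int_{-\pi}^{\pi}f(\theta)e^{-{\rm i}k\theta}\,d\theta\in\mathbb C^{s\times t}$, $k\in\mathbb Z$, and $T_m(f)=[f_{i-j}]_{i,j=1}^m\in\mathbb C^{ms\times mt}$. For $a:[0,1]\to\mathbb C^{s\times t}$, $D_m(a)$ is the $ms\times mt$ block diagonal matrix with diagonal blocks $a(i/m)$, $i=1,\ldots,m$. Approximating class of sequences (a.c.s.). Let $\{X_n\}_n$ be a sequence of matrices with $X_n$ of size $p_n\times q_n$, and for each $m$ let $\{B_{n,m}\}_n$ be a sequence of matrices with $B_{n,m}$ of size $p_n\times q_n$. Write $\{B_{n,m}\}_n\xrightarrow{\rm a.c.s.}\{X_n\}_n$ if for every $m$ there exists $n_m$ such that, for $n\ge n_m$, $X_n=B_{n,m}+R_{n,m}+N_{n,m}$ with ${\rm rank}(R_{n,m})\le c(m)(p_n\wedge q_n)$ and $\|N_{n,m}\|\le\omega(m)$, where $n_m,c(m),\omega(m)$ depend only on $m$ and $\lim_{m\to\infty}c(m)=\lim_{m\to\infty}\omega(m)=0$. GLT sequences. Let $\{X_n\}_n$ be a sequence of matrices with $X_n$ of size $d_ns\times d_nt$ for fixed positive integers $s,t$ and some positive integer sequence $d_n\to\infty$,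 and let $\kappa:[0,1]\times[-\pi,\pi]\to\mathbb C^{s\times t}$ be measurable. Then $\{X_n\}_n\sim_{\rm GLT}\kappa$ (i.e. $\{X_n\}_n$ is a generalized locally Toeplitz sequence with symbol $\kappa$) means that there exist functions $a_{i,m},f_{i,m}$, $i=1,\ldots,N_m$, such that: $a_{i,m}:[0,1]\to\mathbb C$ is continuous a.e. and $f_{i,m}:[-\pi,\pi]\to\mathbb C^{s\times t}$ is in $L^1([-\pi,\pi])$; $\sum_{i=1}^{N_m}a_{i,m}(x)f_{i,m}(\theta)\to\kappa(x,\theta)$ a.e. on $[0,1]\times[-\pi,\pi]$ as $m\to\infty$; and $\bigl\{\sum_{i=1}^{N_m}D_{d_n}(a_{i,m}I_s)T_{d_n}(f_{i,m})\bigr\}_n\xrightarrow{\rm a.c.s.}\{X_n\}_n$. *)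

theory Defs
  imports "HOL-Analysis.Analysis" "Jordan_Normal_Form.DL_Rank"
begin

unbundle no vec_syntax
hide_const (open) Finite_Cartesian_Product.mat Finite_Cartesian_Product.vec

text \<open>Matrices are elements of the type \<^typ>\<open>complex mat\<close>, with 0-based indices.\<close>

definition vec_norm2 :: "complex vec \<Rightarrow> real" where
  "vec_norm2 v = L2_set (\<lambda>i. cmod (v $ i)) {..<dim_vec v}"

definition op_norm :: "complex mat \<Rightarrow> real" where
  "op_norm A = (SUP v \<in> {v \<in> carrier_vec (dim_col A). vec_norm2 v \<le> 1}. vec_norm2 (A *\<^sub>v v))"

definition mat_rank :: "complex mat \<Rightarrow> nat" where
  "mat_rank A = vec_space.rank (dim_row A) A"

definition mat_sum :: "nat \<Rightarrow> nat \<Rightarrow> ('i \<Rightarrow> complex mat) \<Rightarrow> 'i set \<Rightarrow> complex mat" where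
  "mat_sum nr nc F I = mat nr nc (\<lambda>(i, j). \<Sum>k\<in>I. F k $$ (i, j))"

definition mat_measurable :: "nat \<Rightarrow> nat \<Rightarrow> 'a measure \<Rightarrow> ('a \<Rightarrow> complex mat) \<Rightarrow> bool" where
  "mat_measurable s t M f \<longleftrightarrow>
     f \<in> space M \<rightarrow> carrier_mat s t \<and>
     (\<forall>i<s. \<forall>j<t. (\<lambda>x. f x $$ (i, j)) \<in> borel_measurable M)"

definition mat_integrable :: "nat \<Rightarrow> nat \<Rightarrow> 'a measure \<Rightarrow> ('a \<Rightarrow> complex mat) \<Rightarrow> bool" where
  "mat_integrable s t M f \<longleftrightarrow>
     f \<in> space M \<rightarrow> carrier_mat s t \<and>
     (\<forall>i<s. \<forall>j<t. integrable M (\<lambda>x. f x $$ (i, j)))"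

definition is_partition :: "nat list \<Rightarrow> nat \<Rightarrow> bool" where
  "is_partition ns m \<longleftrightarrow> (\<forall>k\<in>set ns. 0 < k) \<and> sum_list ns = m"

text \<open>The \<open>k\<close>-th diagonal block starts after the first \<open>sum_list (take k ns)\<close>
  block rows and block columns of \<open>A\<close>.\<close>

definition blockdiag :: "nat \<Rightarrow> nat \<Rightarrow> nat list \<Rightarrow> complex mat \<Rightarrow> complex mat" where
  "blockdiag s t ns A = diag_block_mat
     (map (\<lambda>k. mat (ns ! k * s) (ns ! k * t)
            (\<lambda>(i, j). A $$ (sum_list (take k ns) * s + i, sum_list (take k ns) * t + j)))
        [0..<length ns])"

definition fourier_coeff :: "nat \<Rightarrow> nat \<Rightarrow> (real \<Rightarrow> complex mat) \<Rightarrow> int \<Rightarrow> complex mat" where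
  "fourier_coeff s t f k = mat s t (\<lambda>(i, j).
     1 / (2 * of_real pi) *
     (LINT \<theta>|lebesgue_on {-pi..pi}. f \<theta> $$ (i, j) * exp (- \<i> * of_int k * of_real \<theta>)))"

definition toeplitz :: "nat \<Rightarrow> nat \<Rightarrow> nat \<Rightarrow> (real \<Rightarrow> complex mat) \<Rightarrow> complex mat" where
  "toeplitz s t m f = mat (m * s) (m * t) (\<lambda>(i, j).
     fourier_coeff s t f (int (i div s) - int (j div t)) $$ (i mod s, j mod t))"

definition diag_sampling :: "nat \<Rightarrow> (real \<Rightarrow> complex mat) \<Rightarrow> complex mat" where
  "diag_sampling m a = diag_block_mat (map (\<lambda>i. a (real i / real m)) [1..<Suc m])"

text \<open>In the following, \<open>S\<close> is the infinite set of indices in which \<open>n\<close> varies, and the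
  matrices indexed by \<open>n\<close> have size \<open>p n \<times> q n\<close>.\<close>

definition acs :: "nat set \<Rightarrow> (nat \<Rightarrow> nat) \<Rightarrow> (nat \<Rightarrow> nat)
    \<Rightarrow> (nat \<Rightarrow> nat \<Rightarrow> complex mat) \<Rightarrow> (nat \<Rightarrow> complex mat) \<Rightarrow> bool" where
  "acs S p q B X \<longleftrightarrow>
     (\<forall>n\<in>S. X n \<in> carrier_mat (p n) (q n)) \<and>
     (\<forall>m. \<forall>n\<in>S. B n m \<in> carrier_mat (p n) (q n)) \<and>
     (\<exists>(n0 :: nat \<Rightarrow> nat) (c :: nat \<Rightarrow> real) (\<omega> :: nat \<Rightarrow> real).
        c \<longlonglongrightarrow> 0 \<and> \<omega> \<longlonglongrightarrow> 0 \<and>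
        (\<forall>m. \<forall>n\<in>S. n0 m \<le> n \<longrightarrow>
          (\<exists>R N. R \<in> carrier_mat (p n) (q n) \<and> N \<in> carrier_mat (p n) (q n) \<and>
             X n = B n m + R + N \<and>
             real (mat_rank R) \<le> c m * real (min (p n) (q n)) \<and>
             op_norm N \<le> \<omega> m)))"

definition glt :: "nat set \<Rightarrow> nat \<Rightarrow> nat \<Rightarrow> (nat \<Rightarrow> nat) \<Rightarrow> (nat \<Rightarrow> complex mat)
    \<Rightarrow> (real \<times> real \<Rightarrow> complex mat) \<Rightarrow> bool" where
  "glt S s t d X \<kappa> \<longleftrightarrow>
     (\<forall>n\<in>S. X n \<in> carrier_mat (d n * s) (d n * t)) \<and>
     mat_measurable s t (lebesgue_on ({0..1} \<times> {-pi..pi})) \<kappa> \<and>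
     (\<exists>(N :: nat \<Rightarrow> nat) (a :: nat \<Rightarrow> nat \<Rightarrow> real \<Rightarrow> complex)
        (f :: nat \<Rightarrow> nat \<Rightarrow> real \<Rightarrow> complex mat).
        (\<forall>m. \<forall>i\<in>{1..N m}.
           (AE x in lebesgue_on {0..1}. continuous (at x within {0..1}) (a i m)) \<and>
           mat_integrable s t (lebesgue_on {-pi..pi}) (f i m)) \<and>
        (AE (x, \<theta>) in lebesgue_on ({0..1} \<times> {-pi..pi}). \<forall>j<s. \<forall>k<t.
           (\<lambda>m. mat_sum s t (\<lambda>i. a i m x \<cdot>\<^sub>m f i m \<theta>) {1..N m} $$ (j, k))
             \<longlonglongrightarrow> \<kappa> (x, \<theta>) $$ (j, k)) \<and>
        acs S (\<lambda>n. d n * s) (\<lambda>n. d n * t)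
          (\<lambda>n m. mat_sum (d n * s) (d n * t)
             (\<lambda>i. diag_sampling (d n) (\<lambda>x. a i m x \<cdot>\<^sub>m 1\<^sub>m s) * toeplitz s t (d n) (f i m))
             {1..N m})
          X)"

end

theory Submission
  imports Defs
begin

text \<open>Extracting diagonal blocks is a sum of \<open>\<nu>\<close> compressions, hence it preserves splittings into a part
  of small rank and a part of small norm. It therefore suffices that the part of
  \<open>\<Sum>\<^sub>i D(a\<^sub>i I) T(f\<^sub>i)\<close> outside the diagonal blocks is negligible. The factors \<open>D(a\<^sub>i I)\<close> are bounded up to
  few rows, and \<open>f\<^sub>i\<close> reduces to scalar functions \<open>h \<ge> 0\<close>. If \<open>h\<close> is bounded, its Fourier coefficients are
  square summable and the part of \<open>T(h)\<close> outside the blocks has squared Frobenius norm \<open>o(d)\<close>. Truncating \<open>h\<close>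
  leaves a remainder of small integral, whose Toeplitz matrix is positive semidefinite with
  small trace. Greedy subtraction of rank one matrices turns a small Frobenius norm or
  a small trace into a splitting.\<close>

section \<open>Splittings into low rank and small norm\<close>

text \<open>The symbols are merely integrable, so their Fourier coefficients need not be square
  summable, and a Frobenius estimate is available only after truncation. For bounded h the whole
  matrix T(h) is not small, only the part outside the blocks is: it must be cut first and estimated
  afterwards. For the remainder the order is reversed: cutting destroys positivity, so the whole
  Toeplitz matrix is split and the cut follows, at the price of a factor \<nu> + 1. The bookkeeping
  rests on blockdiag(A) - B = blockdiag(A - B) - offd(B), where offd(B) is the part of B outside the
  blocks. Factors \<nu> are harmless because \<nu> is fixed, whereas the block sizes may vary
  arbitrarily with n; hence all thresholds are uniform over the partitions of d into \<nu> parts.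
  Square summability is itself obtained from positivity, by the Cauchy-Schwarz inequality for the
  form of T(h), and greedy deflation takes the place of the singular value decomposition. Matrices
  are handled as functions of two indices, and a rank bound is an explicit number of rank one terms,
  so that sums, masks and embeddings act directly on the terms.\<close>

definition rank_le :: "nat \<Rightarrow> nat \<Rightarrow> nat \<Rightarrow> (nat \<Rightarrow> nat \<Rightarrow> complex) \<Rightarrow> bool" where
  "rank_le p q r F \<longleftrightarrow> (\<exists>u v. \<forall>i<p. \<forall>j<q. F i j = (\<Sum>k<r. u k i * v k j))"

text \<open>The homogeneous form of an operator norm bound avoids the supremum and with it every
  question of boundedness.\<close>

definition norm_le :: "nat \<Rightarrow> nat \<Rightarrow> real \<Rightarrow> (nat \<Rightarrow> nat \<Rightarrow> complex) \<Rightarrow> bool" where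
  "norm_le p q w F \<longleftrightarrow> (\<forall>v. L2_set (\<lambda>i. cmod (\<Sum>j<q. F i j * v j)) {..<p}
     \<le> w * L2_set (\<lambda>j. cmod (v j)) {..<q})"

text \<open>The rank budget \<open>r\<close> is real because it is later a multiple of the matrix
  size, as in the definition of \<open>acs\<close>; \<open>k\<close> is the actual number of rank
  one terms.\<close>

definition splits :: "nat \<Rightarrow> nat \<Rightarrow> real \<Rightarrow> real \<Rightarrow> (nat \<Rightarrow> nat \<Rightarrow> complex) \<Rightarrow> bool" where
  "splits p q r w F \<longleftrightarrow>
     (\<exists>k R. real k \<le> r \<and> rank_le p q k R \<and> norm_le p q w (\<lambda>i j. F i j - R i j))"

lemma rank_le_add:
  assumes "rank_le p q r F" "rank_le p q r' G"
  shows "rank_le p q (r + r') (\<lambda>i j. F i j + G i j)"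
proof -
  obtain u v where uv: "\<forall>i<p. \<forall>j<q. F i j = (\<Sum>k<r. u k i * v k j)"
    using assms(1) unfolding rank_le_def by blast
  obtain u' v' where uv': "\<forall>i<p. \<forall>j<q. G i j = (\<Sum>k<r'. u' k i * v' k j)"
    using assms(2) unfolding rank_le_def by blast
  define U V where "U = (\<lambda>k. if k < r then u k else u' (k - r))"
    and "V = (\<lambda>k. if k < r then v k else v' (k - r))"
  have "(\<Sum>k<r + r'. U k i * V k j) = (\<Sum>k<r. u k i * v k j) + (\<Sum>k<r'. u' k i * v' k j)" for i j
  proof -
    have "(\<Sum>k<r + r'. U k i * V k j) = (\<Sum>k<r. U k i * V k j) + (\<Sum>k<r'. U (k + r) i * V (k + r) j)"
      by (induction r') (simp_all add: add_ac)
    then show ?thesis by (simp add: U_def V_def)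
  qed
  then show ?thesis
    unfolding rank_le_def using uv uv' by (intro exI[of _ U] exI[of _ V]) simp
qed

lemma rank_le_mask:
  assumes "rank_le p q r F"
  shows "rank_le p q r (\<lambda>i j. \<alpha> i * F i j * \<beta> j)"
proof -
  obtain u v where uv: "\<And>i j. i < p \<Longrightarrow> j < q \<Longrightarrow> F i j = (\<Sum>k<r. u k i * v k j)"
    using assms unfolding rank_le_def by metis
  show ?thesis
    unfolding rank_le_def
    by (rule exI[of _ "\<lambda>k i. \<alpha> i * u k i"], rule exI[of _ "\<lambda>k j. v k j * \<beta> j"])
      (simp add: uv sum_distrib_left sum_distrib_right mult_ac)
qed

lemma norm_leD: "norm_le p q w F \<Longrightarrow> L2_set (\<lambda>i. cmod (\<Sum>j<q. F i j * v j)) {..<p}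
     \<le> w * L2_set (\<lambda>j. cmod (v j)) {..<q}"
  by (simp add: norm_le_def)

lemma norm_le_cong:
  assumes "norm_le p q w F" "\<And>i j. i < p \<Longrightarrow> j < q \<Longrightarrow> F i j = G i j"
  shows "norm_le p q w G"
  unfolding norm_le_def
proof
  fix v
  have "L2_set (\<lambda>i. cmod (\<Sum>j<q. G i j * v j)) {..<p} = L2_set (\<lambda>i. cmod (\<Sum>j<q. F i j * v j)) {..<p}"
    using assms(2) by (intro L2_set_cong) auto
  then show "L2_set (\<lambda>i. cmod (\<Sum>j<q. G i j * v j)) {..<p} \<le> w * L2_set (\<lambda>j. cmod (v j)) {..<q}"
    using norm_leD[OF assms(1), of v] by simp
qed

lemma norm_le_mono: "norm_le p q w F \<Longrightarrow> w \<le> w' \<Longrightarrow> norm_le p q w' F"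
  unfolding norm_le_def using order_trans[OF _ mult_right_mono[OF _ L2_set_nonneg]] by blast

lemma norm_le_add:
  assumes "norm_le p q w F" "norm_le p q w' G"
  shows "norm_le p q (w + w') (\<lambda>i j. F i j + G i j)"
  unfolding norm_le_def
proof
  fix v
  have "L2_set (\<lambda>i. cmod (\<Sum>j<q. (F i j + G i j) * v j)) {..<p}
      = L2_set (\<lambda>i. cmod ((\<Sum>j<q. F i j * v j) + (\<Sum>j<q. G i j * v j))) {..<p}"
    by (simp add: algebra_simps sum.distrib)
  also have "\<dots> \<le> L2_set (\<lambda>i. cmod (\<Sum>j<q. F i j * v j) + cmod (\<Sum>j<q. G i j * v j)) {..<p}"
    by (intro L2_set_mono norm_triangle_ineq) auto
  also have "\<dots> \<le> L2_set (\<lambda>i. cmod (\<Sum>j<q. F i j * v j)) {..<p} + L2_set (\<lambda>i. cmod (\<Sum>j<q. G i j * v j)) {..<p}"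
    by (rule L2_set_triangle_ineq)
  also have "\<dots> \<le> (w + w') * L2_set (\<lambda>j. cmod (v j)) {..<q}"
    using norm_leD[OF assms(1), of v] norm_leD[OF assms(2), of v] by (simp add: algebra_simps)
  finally show "L2_set (\<lambda>i. cmod (\<Sum>j<q. (F i j + G i j) * v j)) {..<p}
     \<le> (w + w') * L2_set (\<lambda>j. cmod (v j)) {..<q}" .
qed

lemma norm_le_mask:
  assumes "norm_le p q w F" "w \<ge> 0" "\<And>i. cmod (\<alpha> i) \<le> M" "\<And>j. cmod (\<beta> j) \<le> 1"
  shows "norm_le p q (M * w) (\<lambda>i j. \<alpha> i * F i j * \<beta> j)"
  unfolding norm_le_def
proof
  fix v
  have M: "M \<ge> 0" using assms(3)[of 0] norm_ge_zero[of "\<alpha> 0"] by linarith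
  have "L2_set (\<lambda>i. cmod (\<Sum>j<q. \<alpha> i * F i j * \<beta> j * v j)) {..<p}
      = L2_set (\<lambda>i. cmod (\<alpha> i) * cmod (\<Sum>j<q. F i j * (\<beta> j * v j))) {..<p}"
    by (simp add: sum_distrib_left mult_ac flip: norm_mult)
  also have "\<dots> \<le> L2_set (\<lambda>i. M * cmod (\<Sum>j<q. F i j * (\<beta> j * v j))) {..<p}"
    using assms(3) by (intro L2_set_mono mult_right_mono) auto
  also have "\<dots> = M * L2_set (\<lambda>i. cmod (\<Sum>j<q. F i j * (\<beta> j * v j))) {..<p}"
    using M by (simp add: L2_set_right_distrib)
  also have "\<dots> \<le> M * (w * L2_set (\<lambda>j. cmod (\<beta> j * v j)) {..<q})"
    by (intro mult_left_mono norm_leD assms M)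
  also have "\<dots> \<le> M * (w * L2_set (\<lambda>j. cmod (v j)) {..<q})"
    using assms(4) by (intro mult_left_mono L2_set_mono M assms(2))
      (auto simp: norm_mult mult_left_le_one_le)
  finally show "L2_set (\<lambda>i. cmod (\<Sum>j<q. \<alpha> i * F i j * \<beta> j * v j)) {..<p}
     \<le> M * w * L2_set (\<lambda>j. cmod (v j)) {..<q}" by (simp add: mult_ac)
qed

lemma norm_le_zero: "norm_le p q 0 (\<lambda>i j. 0)"
  by (simp add: norm_le_def L2_set_def)

lemma splitsI: "real k \<le> r \<Longrightarrow> rank_le p q k R \<Longrightarrow> norm_le p q w (\<lambda>i j. F i j - R i j) \<Longrightarrow> splits p q r w F"
  unfolding splits_def by blast

lemma splits_cong:
  assumes "splits p q r w F" "\<And>i j. i < p \<Longrightarrow> j < q \<Longrightarrow> F i j = G i j"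
  shows "splits p q r w G"
proof -
  obtain k R where *: "real k \<le> r" "rank_le p q k R" "norm_le p q w (\<lambda>i j. F i j - R i j)"
    using assms(1) unfolding splits_def by blast
  show ?thesis by (rule splitsI[OF *(1,2)], rule norm_le_cong[OF *(3)]) (simp add: assms(2))
qed

lemma splits_mono: "splits p q r w F \<Longrightarrow> r \<le> r' \<Longrightarrow> w \<le> w' \<Longrightarrow> splits p q r' w' F"
  unfolding splits_def using norm_le_mono order_trans by blast

lemma splits_add:
  assumes "splits p q r w F" "splits p q r' w' G"
  shows "splits p q (r + r') (w + w') (\<lambda>i j. F i j + G i j)"
proof -
  obtain k R where 1: "real k \<le> r" "rank_le p q k R" "norm_le p q w (\<lambda>i j. F i j - R i j)"
    using assms(1) unfolding splits_def by blast
  obtain k' R' where 2: "real k' \<le> r'" "rank_le p q k' R'" "norm_le p q w' (\<lambda>i j. G i j - R' i j)"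
    using assms(2) unfolding splits_def by blast
  show ?thesis
    by (rule splitsI[OF _ rank_le_add[OF 1(2) 2(2)]],
        use 1(1) 2(1) in simp, rule norm_le_cong[OF norm_le_add[OF 1(3) 2(3)]]) simp
qed

text \<open>Diagonal scaling on both sides is absorbed into the factors of each rank one term, so
  only the norm budget changes. It serves for compressions (indicators), for signs and for bounded
  row multipliers.\<close>

lemma splits_mask:
  assumes "splits p q r w F" "w \<ge> 0" "\<And>i. cmod (\<alpha> i) \<le> M" "\<And>j. cmod (\<beta> j) \<le> 1"
  shows "splits p q r (M * w) (\<lambda>i j. \<alpha> i * F i j * \<beta> j)"
proof -
  obtain k R where 1: "real k \<le> r" "rank_le p q k R" "norm_le p q w (\<lambda>i j. F i j - R i j)"
    using assms(1) unfolding splits_def by blast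
  show ?thesis
    by (rule splitsI[OF 1(1) rank_le_mask[OF 1(2), of \<alpha> \<beta>]],
        rule norm_le_cong[OF norm_le_mask[OF 1(3) assms(2), of \<alpha> M \<beta>, OF assms(3,4)]])
      (simp add: algebra_simps)
qed

lemma splits_zero: "r \<ge> 0 \<Longrightarrow> w \<ge> 0 \<Longrightarrow> splits p q r w (\<lambda>i j. 0)"
  by (rule splitsI[of 0 _ _ _ "\<lambda>i j. 0"])
    (auto simp: rank_le_def intro: norm_le_mono[OF norm_le_zero])

lemma splits_sum:
  assumes "finite I" "\<And>x. x \<in> I \<Longrightarrow> splits p q (r x) (w x) (F x)"
  shows "splits p q (sum r I) (sum w I) (\<lambda>i j. \<Sum>x\<in>I. F x i j)"
  using assms by (induction I) (simp_all add: splits_zero splits_add)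

text \<open>A matrix with a single nonzero row has rank at most one. This is how exceptional rows
  are paid for, whatever the size of their entries.\<close>

lemma splits_rows:
  assumes "finite T" "\<And>i j. i < p \<Longrightarrow> j < q \<Longrightarrow> i \<notin> T \<Longrightarrow> F i j = 0"
  shows "splits p q (card T) 0 F"
proof -
  obtain g where g: "bij_betw g {..<card T} T"
    using ex_bij_betw_nat_finite[OF assms(1)] by (auto simp: atLeast0LessThan)
  have "F i j = (\<Sum>k<card T. (if i = g k then 1 else 0) * F (g k) j)" if "i < p" "j < q" for i j
  proof -
    have "(\<Sum>k<card T. (if i = g k then 1 else 0) * F (g k) j) = (\<Sum>x\<in>T. (if i = x then 1 else 0) * F x j)"
      by (rule sum.reindex_bij_betw[OF g])
    also have "\<dots> = (\<Sum>x\<in>T. if x = i then F i j else 0)" by (intro sum.cong) auto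
    also have "\<dots> = F i j" using assms that by simp
    finally show ?thesis by simp
  qed
  note * = this
  have "rank_le p q (card T) F" unfolding rank_le_def
    by (rule exI[of _ "\<lambda>k i. if i = g k then 1 else 0"], rule exI[of _ "\<lambda>k. F (g k)"])
      (intro allI impI *)
  then show ?thesis by (rule splitsI[rotated]) (simp_all add: norm_le_zero)
qed

section \<open>Scalar matrices placed inside block matrices\<close>

lemma sum_residue_class:
  fixes g :: "nat \<Rightarrow> 'a::comm_monoid_add"
  assumes "a < s"
  shows "(\<Sum>x<d * s. if x mod s = a then g (x div s) else 0) = (\<Sum>i<d. g i)"
proof -
  have less: "i * s + a < d * s" if "i < d" for i
    using mult_le_mono1[of "Suc i" d s] that assms by simp
  have "(\<Sum>x<d * s. if x mod s = a then g (x div s) else 0)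
      = (\<Sum>x\<in>{x \<in> {..<d * s}. x mod s = a}. g (x div s))"
    by (rule sum.inter_filter[symmetric]) simp
  also have "\<dots> = (\<Sum>i<d. g i)"
    by (rule sum.reindex_bij_witness[where i = "\<lambda>i. i * s + a" and j = "\<lambda>x. x div s"])
      (use assms less in \<open>auto simp: less_mult_imp_div_less\<close>)
  finally show ?thesis .
qed

text \<open>The embedded matrix is the Kronecker product of \<open>F\<close> with the matrix unit at
  (a, b). It sees only the coordinates of \<open>v\<close> in the residue class b modulo t and fills
  only the rows in the class a modulo s, so neither rank nor norm grows.\<close>

lemma splits_embed:
  assumes "splits d d r w F" "w \<ge> 0" "a < s" "b < t"
  shows "splits (d * s) (d * t) r w
    (\<lambda>i j. if i mod s = a \<and> j mod t = b then F (i div s) (j div t) else 0)"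
proof -
  let ?E = "\<lambda>F i j. if i mod s = a \<and> j mod t = b then F (i div s) (j div t) else (0 :: complex)"
  obtain k R where 1: "real k \<le> r" "rank_le d d k R" "norm_le d d w (\<lambda>i j. F i j - R i j)"
    using assms(1) unfolding splits_def by blast
  have rank: "rank_le (d * s) (d * t) k (?E R)"
  proof -
    obtain u v where uv: "\<And>i j. i < d \<Longrightarrow> j < d \<Longrightarrow> R i j = (\<Sum>k<k. u k i * v k j)"
      using 1(2) unfolding rank_le_def by metis
    show ?thesis unfolding rank_le_def
      by (rule exI[of _ "\<lambda>k i. if i mod s = a then u k (i div s) else 0"],
          rule exI[of _ "\<lambda>k j. if j mod t = b then v k (j div t) else 0"])
        (auto simp: uv less_mult_imp_div_less)
  qed
  have "norm_le (d * s) (d * t) w (?E G)" if G: "norm_le d d w G" for G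
    unfolding norm_le_def
  proof
    fix v :: "nat \<Rightarrow> complex"
    define v' where "v' j = v (j * t + b)" for j
    have v': "v j = v' (j div t)" if "j mod t = b" for j
      using that div_mult_mod_eq[of j t] by (simp add: v'_def)
    have in_eq: "(\<Sum>j<d * t. ?E G i j * v j)
        = (if i mod s = a then \<Sum>j<d. G (i div s) j * v' j else 0)" for i
    proof (cases "i mod s = a")
      case True
      have "(\<Sum>j<d * t. ?E G i j * v j)
          = (\<Sum>j<d * t. if j mod t = b then G (i div s) (j div t) * v' (j div t) else 0)"
        using True by (intro sum.cong) (auto simp: v')
      also have "\<dots> = (\<Sum>j<d. G (i div s) j * v' j)"
        by (rule sum_residue_class[OF assms(4)])
      finally show ?thesis using True by simp
    qed simp
    have "(\<Sum>i<d * s. (cmod (\<Sum>j<d * t. ?E G i j * v j))\<^sup>2)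
        = (\<Sum>i<d * s. if i mod s = a then (cmod (\<Sum>j<d. G (i div s) j * v' j))\<^sup>2 else 0)"
      by (intro sum.cong refl) (simp add: in_eq)
    also have "\<dots> = (\<Sum>i<d. (cmod (\<Sum>j<d. G i j * v' j))\<^sup>2)"
      by (rule sum_residue_class[OF assms(3)])
    finally have "L2_set (\<lambda>i. cmod (\<Sum>j<d * t. ?E G i j * v j)) {..<d * s}
        = L2_set (\<lambda>i. cmod (\<Sum>j<d. G i j * v' j)) {..<d}"
      by (simp add: L2_set_def)
    also have "\<dots> \<le> w * L2_set (\<lambda>j. cmod (v' j)) {..<d}"
      by (rule norm_leD[OF G])
    also have "L2_set (\<lambda>j. cmod (v' j)) {..<d} \<le> L2_set (\<lambda>j. cmod (v j)) {..<d * t}"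
    proof -
      have "(\<Sum>j<d. (cmod (v' j))\<^sup>2) = (\<Sum>j<d * t. if j mod t = b then (cmod (v' (j div t)))\<^sup>2 else 0)"
        by (rule sum_residue_class[OF assms(4), symmetric])
      also have "\<dots> \<le> (\<Sum>j<d * t. (cmod (v j))\<^sup>2)"
        by (intro sum_mono) (auto simp: v')
      finally show ?thesis by (simp add: L2_set_def)
    qed
    finally show "L2_set (\<lambda>i. cmod (\<Sum>j<d * t. ?E G i j * v j)) {..<d * s}
        \<le> w * L2_set (\<lambda>j. cmod (v j)) {..<d * t}"
      using assms(2) by (simp add: mult_left_mono)
  qed
  from this[OF 1(3)] have "norm_le (d * s) (d * t) w (\<lambda>i j. ?E F i j - ?E R i j)"
    by (rule norm_le_cong) auto
  then show ?thesis by (rule splitsI[OF 1(1) rank])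
qed

section \<open>Greedy deflation\<close>

text \<open>By homogeneity a violating vector can be normalised; it is nonzero on the indices below
  \<open>q\<close>, since otherwise both sides would vanish.\<close>

lemma not_norm_leE:
  assumes "\<not> norm_le p q w F"
  obtains v where "(\<Sum>j<q. (cmod (v j))\<^sup>2) = 1" "w < L2_set (\<lambda>i. cmod (\<Sum>j<q. F i j * v j)) {..<p}"
proof -
  obtain v where v: "w * L2_set (\<lambda>j. cmod (v j)) {..<q} < L2_set (\<lambda>i. cmod (\<Sum>j<q. F i j * v j)) {..<p}"
    using assms by (auto simp: norm_le_def not_le)
  define l where "l = L2_set (\<lambda>j. cmod (v j)) {..<q}"
  have "l \<noteq> 0"
  proof
    assume "l = 0"
    then have "v j = 0" if "j < q" for j using that by (simp add: l_def L2_set_eq_0_iff)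
    then have "L2_set (\<lambda>i. cmod (\<Sum>j<q. F i j * v j)) {..<p} = 0" by (simp add: L2_set_eq_0_iff)
    then show False using v \<open>l = 0\<close> by (simp add: l_def)
  qed
  then have l: "l > 0" by (simp add: l_def less_le)
  define v' where "v' j = v j / of_real l" for j
  have "L2_set (\<lambda>j. cmod (v' j)) {..<q} = 1"
    using l L2_set_right_distrib[of "1 / l" "\<lambda>j. cmod (v j)" "{..<q}"]
    by (simp add: v'_def norm_divide l_def[symmetric])
  then have 1: "(\<Sum>j<q. (cmod (v' j))\<^sup>2) = 1" by (simp add: L2_set_def)
  have "L2_set (\<lambda>i. cmod (\<Sum>j<q. F i j * v' j)) {..<p}
      = L2_set (\<lambda>i. 1 / l * cmod (\<Sum>j<q. F i j * v j)) {..<p}"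
    using l by (simp add: v'_def norm_divide flip: sum_divide_distrib)
  also have "\<dots> = 1 / l * L2_set (\<lambda>i. cmod (\<Sum>j<q. F i j * v j)) {..<p}"
    by (rule L2_set_right_distrib[symmetric]) (use l in simp)
  also have "\<dots> > w" using v l by (simp add: l_def[symmetric] pos_less_divide_eq)
  finally show ?thesis using that 1 by blast
qed

lemma splits_rank_one: "splits p q 1 0 (\<lambda>i j. u i * v j)"
proof -
  have "rank_le p q 1 (\<lambda>i j. u i * v j)"
    unfolding rank_le_def by (intro exI[of _ "\<lambda>_. u"] exI[of _ "\<lambda>_. v"]) simp
  then show ?thesis by (rule splitsI[rotated]) (simp_all add: norm_le_zero)
qed

text \<open>Greedy deflation: as long as the norm exceeds \<open>w\<close>, one subtracts a matrix of rank one, and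
  every such step consumes at least \<open>\<delta>\<close> of the potential \<open>\<Phi>\<close>.\<close>

lemma splits_greedy:
  assumes step: "\<And>F. C F \<Longrightarrow> \<not> norm_le p q w F \<Longrightarrow>
      \<exists>u v. C (\<lambda>i j. F i j - u i * v j) \<and> \<Phi> (\<lambda>i j. F i j - u i * v j) \<le> \<Phi> F - \<delta>"
    and nonneg: "\<And>F. C F \<Longrightarrow> 0 \<le> \<Phi> F" and "\<delta> > 0" and "C F"
  shows "splits p q (\<Phi> F / \<delta>) w F"
proof -
  \<comment> \<open>Induction on the number \<open>k\<close> of steps the potential can pay for:
    with less than \<delta> left, a further step would make it negative. \<open>C\<close> is the
    invariant that deflation preserves.\<close>
  have *: "splits p q (real k) w F" if "C F" "\<Phi> F < real (Suc k) * \<delta>" for k F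
    using that
  proof (induction k arbitrary: F)
    case 0
    show ?case
    proof (rule ccontr)
      assume "\<not> splits p q (real 0) w F"
      then have "\<not> norm_le p q w F"
        using splitsI[of 0 0 p q "\<lambda>i j. 0" w F] by (auto simp: rank_le_def)
      then obtain u v where "C (\<lambda>i j. F i j - u i * v j)" "\<Phi> (\<lambda>i j. F i j - u i * v j) \<le> \<Phi> F - \<delta>"
        using step[OF 0(1)] by blast
      then show False using nonneg[of "\<lambda>i j. F i j - u i * v j"] 0(2) by simp
    qed
  next
    case (Suc k)
    show ?case
    proof (cases "norm_le p q w F")
      case True
      then show ?thesis by (intro splitsI[of 0 _ _ _ "\<lambda>i j. 0"]) (auto simp: rank_le_def)
    next
      case False
      then obtain u v where uv: "C (\<lambda>i j. F i j - u i * v j)"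
          "\<Phi> (\<lambda>i j. F i j - u i * v j) \<le> \<Phi> F - \<delta>"
        using step[OF Suc.prems(1)] by blast
      have "splits p q (real k) w (\<lambda>i j. F i j - u i * v j)"
        using uv Suc.prems(2) by (intro Suc.IH) (auto simp: algebra_simps)
      from splits_add[OF this splits_rank_one[of p q u v]]
      show ?thesis by (simp add: add.commute)
    qed
  qed
  define k where "k = nat \<lfloor>\<Phi> F / \<delta>\<rfloor>"
  have k: "real k \<le> \<Phi> F / \<delta>" "\<Phi> F / \<delta> < real (Suc k)"
    using nonneg[OF \<open>C F\<close>] \<open>\<delta> > 0\<close> by (auto simp: k_def of_nat_nat) linarith+
  have "splits p q (real k) w F"
    using * \<open>C F\<close> k(2) \<open>\<delta> > 0\<close> by (simp add: pos_divide_less_eq)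
  then show ?thesis by (rule splits_mono) (use k in auto)
qed

text \<open>Pythagoras: the subtracted vector is the orthogonal projection of the row
  \<open>F\<close> onto the unit vector \<open>cnj v\<close>.\<close>

lemma sum_cmod2_minus_projection:
  fixes F v :: "nat \<Rightarrow> complex"
  assumes "(\<Sum>j<q. (cmod (v j))\<^sup>2) = 1" and y: "y = (\<Sum>j<q. F j * v j)"
  shows "(\<Sum>j<q. (cmod (F j - y * cnj (v j)))\<^sup>2) = (\<Sum>j<q. (cmod (F j))\<^sup>2) - (cmod y)\<^sup>2"
proof -
  have one: "(\<Sum>j<q. v j * cnj (v j)) = 1"
    using arg_cong[OF assms(1), of complex_of_real] by (simp add: complex_norm_square del: of_real_power)
  have "complex_of_real (\<Sum>j<q. (cmod (F j - y * cnj (v j)))\<^sup>2)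
      = (\<Sum>j<q. F j * cnj (F j) - cnj y * (F j * v j) - y * cnj (F j * v j) + y * cnj y * (v j * cnj (v j)))"
    unfolding of_real_sum by (intro sum.cong refl) (simp add: complex_norm_square algebra_simps del: of_real_power)
  also have "\<dots> = (\<Sum>j<q. F j * cnj (F j)) - cnj y * y - y * cnj y + y * cnj y * 1"
    by (simp add: sum.distrib sum_subtractf y one[symmetric] del: complex_cnj_mult flip: sum_distrib_left cnj_sum)
  also have "\<dots> = complex_of_real ((\<Sum>j<q. (cmod (F j))\<^sup>2) - (cmod y)\<^sup>2)"
    by (simp add: complex_norm_square mult.commute del: of_real_power)
  finally show ?thesis by (simp only: of_real_eq_iff)
qed

text \<open>The potential is the squared Frobenius norm. Projecting every row off a unit vector v
  with |F v| > w lowers it by |F v|^2, which exceeds w^2.\<close>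

lemma splits_frobenius:
  assumes "w > 0"
  shows "splits p q ((\<Sum>i<p. \<Sum>j<q. (cmod (F i j))\<^sup>2) / w\<^sup>2) w F"
proof (rule splits_greedy[where C = "\<lambda>_. True" and \<Phi> = "\<lambda>F. \<Sum>i<p. \<Sum>j<q. (cmod (F i j))\<^sup>2"])
  fix F assume "\<not> norm_le p q w F"
  then obtain v where v: "(\<Sum>j<q. (cmod (v j))\<^sup>2) = 1"
      "w < L2_set (\<lambda>i. cmod (\<Sum>j<q. F i j * v j)) {..<p}"
    by (rule not_norm_leE)
  define y where "y i = (\<Sum>j<q. F i j * v j)" for i
  have "(\<Sum>i<p. \<Sum>j<q. (cmod (F i j - y i * cnj (v j)))\<^sup>2)
      = (\<Sum>i<p. \<Sum>j<q. (cmod (F i j))\<^sup>2) - (\<Sum>i<p. (cmod (y i))\<^sup>2)"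
    by (simp add: sum_cmod2_minus_projection[OF v(1) y_def] sum_subtractf)
  moreover have "w\<^sup>2 \<le> (\<Sum>i<p. (cmod (y i))\<^sup>2)"
    using v(2) assms by (simp add: L2_set_def y_def[symmetric] real_less_rsqrt less_imp_le real_le_lsqrt
        sqrt_le_D power2_le_iff_abs_le) (meson less_imp_le linorder_not_le real_le_lsqrt sum_nonneg zero_le_power2)
  ultimately show "\<exists>u v. True \<and> (\<Sum>i<p. \<Sum>j<q. (cmod (F i j - u i * v j))\<^sup>2)
      \<le> (\<Sum>i<p. \<Sum>j<q. (cmod (F i j))\<^sup>2) - w\<^sup>2"
    by (intro exI[of _ y] exI[of _ "\<lambda>j. cnj (v j)"]) simp
qed (use assms in \<open>auto intro!: sum_nonneg\<close>)

section \<open>Positive semidefinite matrices: Cauchy-Schwarz, deflation and column bounds\<close>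

text \<open>This is u^H F v, conjugate linear in \<open>u\<close>.\<close>

definition sesq :: "nat \<Rightarrow> (nat \<Rightarrow> nat \<Rightarrow> complex) \<Rightarrow> (nat \<Rightarrow> complex) \<Rightarrow> (nat \<Rightarrow> complex) \<Rightarrow> complex" where
  "sesq n F u v = (\<Sum>i<n. cnj (u i) * (\<Sum>j<n. F i j * v j))"

definition psd :: "nat \<Rightarrow> (nat \<Rightarrow> nat \<Rightarrow> complex) \<Rightarrow> bool" where
  "psd n F \<longleftrightarrow> (\<forall>i<n. \<forall>j<n. cnj (F i j) = F j i) \<and> (\<forall>v. 0 \<le> Re (sesq n F v v))"

lemma psd_sesq_cnj:
  assumes "psd n F"
  shows "sesq n F v u = cnj (sesq n F u v)"
proof -
  have "cnj (sesq n F u v) = (\<Sum>i<n. \<Sum>j<n. u i * cnj (F i j) * cnj (v j))"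
    by (simp add: sesq_def sum_distrib_left mult_ac)
  also have "\<dots> = (\<Sum>i<n. \<Sum>j<n. cnj (v j) * F j i * u i)"
    using assms by (intro sum.cong refl) (simp add: psd_def mult_ac)
  also have "\<dots> = (\<Sum>j<n. \<Sum>i<n. cnj (v j) * F j i * u i)" by (rule sum.swap)
  also have "\<dots> = sesq n F v u" by (simp add: sesq_def sum_distrib_left mult_ac)
  finally show ?thesis by simp
qed

lemma sesq_diff:
  "sesq n F (\<lambda>i. u i - c * v i) (\<lambda>i. u i - c * v i)
    = sesq n F u u - c * sesq n F u v - cnj c * sesq n F v u + cnj c * c * sesq n F v v"
proof -
  have "(\<Sum>j<n. F i j * (u j - c * v j)) = (\<Sum>j<n. F i j * u j) - c * (\<Sum>j<n. F i j * v j)" for i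
    by (simp add: right_diff_distrib sum_subtractf sum_distrib_left mult_ac)
  then show ?thesis
    by (simp add: sesq_def algebra_simps sum_subtractf sum.distrib sum_distrib_left)
qed

text \<open>The form may be degenerate, so the inequality is read off from a quadratic polynomial in
  a real parameter.\<close>

lemma psd_Cauchy_Schwarz:
  assumes "psd n F"
  shows "(cmod (sesq n F v u))\<^sup>2 \<le> Re (sesq n F u u) * Re (sesq n F v v)"
proof -
  define b where "b = sesq n F v u"
  define \<alpha> \<beta> where "\<alpha> = Re (sesq n F u u)" and "\<beta> = Re (sesq n F v v)"
  have nonneg: "\<alpha> \<ge> 0" "\<beta> \<ge> 0" using assms by (auto simp: \<alpha>_def \<beta>_def psd_def)
  have bb: "b * cnj b = of_real ((cmod b)\<^sup>2)" by (simp only: complex_norm_square)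
  \<comment> \<open>The test vector is u - t b v with b = v^H F u: the phase of b makes both cross
    terms equal to the real number t |b|^2.\<close>
  have quad: "0 \<le> \<alpha> - 2 * t * (cmod b)\<^sup>2 + t\<^sup>2 * (cmod b)\<^sup>2 * \<beta>" for t :: real
  proof -
    define c where "c = of_real t * b"
    have uv: "sesq n F u v = cnj b" unfolding b_def by (rule psd_sesq_cnj[OF assms])
    have "0 \<le> Re (sesq n F (\<lambda>i. u i - c * v i) (\<lambda>i. u i - c * v i))"
      using assms by (simp add: psd_def)
    also have "\<dots> = Re (sesq n F u u - of_real t * (b * cnj b) - of_real t * (b * cnj b)
        + of_real (t\<^sup>2) * (b * cnj b) * sesq n F v v)"
      unfolding sesq_diff uv c_def b_def[symmetric] of_real_power
      by (rule arg_cong[of _ _ Re]) (simp add: power2_eq_square mult_ac)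
    also have "\<dots> = \<alpha> - t * (cmod b)\<^sup>2 - t * (cmod b)\<^sup>2 + t\<^sup>2 * (cmod b)\<^sup>2 * \<beta>"
      unfolding bb of_real_mult[symmetric] \<alpha>_def \<beta>_def
      by (simp only: plus_complex.simps minus_complex.simps Re_complex_of_real
          times_complex.simps Im_complex_of_real mult_zero_left diff_zero)
    also have "\<dots> = \<alpha> - 2 * t * (cmod b)\<^sup>2 + t\<^sup>2 * (cmod b)\<^sup>2 * \<beta>" by simp
    finally show ?thesis .
  qed
  have "(cmod b)\<^sup>2 \<le> \<alpha> * \<beta>"
  proof (cases "\<beta> = 0")
    case False
    then have "\<beta> > 0" using nonneg by simp
    then show ?thesis using quad[of "1 / \<beta>"] by (simp add: field_simps power2_eq_square)
  next
    case True
    show ?thesis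
    proof (rule ccontr)
      assume "\<not> (cmod b)\<^sup>2 \<le> \<alpha> * \<beta>"
      then have "(cmod b)\<^sup>2 > 0" using True by simp
      \<comment> \<open>With \<beta> = 0 the polynomial is affine in t; at this t it takes the value
        - \<alpha> - 2.\<close>
      then show False using quad[of "(\<alpha> + 1) / (cmod b)\<^sup>2"] True nonneg by simp
    qed
  qed
  then show ?thesis by (simp add: b_def \<alpha>_def \<beta>_def)
qed

lemma sesq_unit: "k < n \<Longrightarrow> sesq n F u (\<lambda>j. if j = k then 1 else 0) = (\<Sum>i<n. cnj (u i) * F i k)"
  by (simp add: sesq_def if_distrib sum.delta cong: if_cong)

lemma psd_diag_nonneg:
  assumes "psd n F" "k < n"
  shows "0 \<le> Re (F k k)"
proof -
  have "0 \<le> Re (sesq n F (\<lambda>j. if j = k then 1 else 0) (\<lambda>j. if j = k then 1 else 0))"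
    using assms by (simp add: psd_def)
  also have "\<dots> = Re (F k k)"
  proof -
    have "(\<Sum>i<n. cnj (if i = k then 1 else 0) * F i k) = (\<Sum>i<n. if i = k then F i k else 0)"
      by (intro sum.cong) auto
    then show ?thesis unfolding sesq_unit[OF assms(2)] using assms(2) by simp
  qed
  finally show ?thesis .
qed

text \<open>With y = F v the new matrix is F - y y^H / (v^H F v), a Schur complement in the
  direction v. Its form at u is u^H F u - |u^H F v|^2 / \<beta>, which is nonnegative by
  Cauchy-Schwarz.\<close>

lemma psd_deflate:
  assumes "psd n F" and y: "\<And>i. y i = (\<Sum>j<n. F i j * v j)"
    and \<beta>: "\<beta> = Re (sesq n F v v)" "\<beta> > 0"
  shows "psd n (\<lambda>i j. F i j - y i * (cnj (y j) / of_real \<beta>))"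
proof -
  have "0 \<le> Re (sesq n (\<lambda>i j. F i j - y i * (cnj (y j) / of_real \<beta>)) u u)" for u
  proof -
    have uv: "sesq n F u v = (\<Sum>i<n. cnj (u i) * y i)" by (simp add: sesq_def y)
    define K where "K = cnj (sesq n F u v) / of_real \<beta>"
    have "(\<Sum>j<n. (F i j - y i * (cnj (y j) / of_real \<beta>)) * u j)
        = (\<Sum>j<n. F i j * u j - y i / of_real \<beta> * (u j * cnj (y j)))" for i
      by (intro sum.cong refl) (simp add: algebra_simps)
    also have "\<dots> i = (\<Sum>j<n. F i j * u j) - y i / of_real \<beta> * (\<Sum>j<n. u j * cnj (y j))" for i
      by (simp only: sum_subtractf sum_distrib_left)
    also have "\<dots> i = (\<Sum>j<n. F i j * u j) - y i * K" for i
      by (simp add: K_def uv)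
    finally have in_eq: "(\<Sum>j<n. (F i j - y i * (cnj (y j) / of_real \<beta>)) * u j)
        = (\<Sum>j<n. F i j * u j) - y i * K" for i .
    have "sesq n (\<lambda>i j. F i j - y i * (cnj (y j) / of_real \<beta>)) u u
        = (\<Sum>i<n. cnj (u i) * (\<Sum>j<n. F i j * u j) - cnj (u i) * y i * K)"
      unfolding sesq_def in_eq by (intro sum.cong refl) (simp add: right_diff_distrib)
    also have "\<dots> = sesq n F u u - sesq n F u v * K"
      unfolding sum_subtractf sum_distrib_right[symmetric] uv by (simp add: sesq_def)
    also have "\<dots> = sesq n F u u - of_real ((cmod (sesq n F u v))\<^sup>2 / \<beta>)"
      unfolding K_def by (simp add: complex_norm_square del: of_real_power)
    finally have "Re (sesq n (\<lambda>i j. F i j - y i * (cnj (y j) / of_real \<beta>)) u u)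
        = Re (sesq n F u u) - (cmod (sesq n F u v))\<^sup>2 / \<beta>" by simp
    moreover have "(cmod (sesq n F u v))\<^sup>2 / \<beta> \<le> Re (sesq n F u u)"
      using psd_Cauchy_Schwarz[OF assms(1), of u v] \<beta> by (simp add: pos_divide_le_eq mult.commute)
    ultimately show ?thesis by simp
  qed
  then show ?thesis using assms(1) by (auto simp: psd_def)
qed

text \<open>The potential is the trace. For a unit vector v with l = |F v| > w, deflation lowers it
  by l^2 / (v^H F v), and v^H F v is at most l, so each step gains at least l. The budget is
  therefore trace / w, linear in 1 / w.\<close>

lemma splits_psd:
  assumes "psd n F" "w > 0"
  shows "splits n n ((\<Sum>i<n. Re (F i i)) / w) w F"
proof (rule splits_greedy[where C = "psd n" and \<Phi> = "\<lambda>F. \<Sum>i<n. Re (F i i)"])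
  fix F assume F: "psd n F" and "\<not> norm_le n n w F"
  then obtain v where v: "(\<Sum>j<n. (cmod (v j))\<^sup>2) = 1"
      "w < L2_set (\<lambda>i. cmod (\<Sum>j<n. F i j * v j)) {..<n}"
    by (blast elim: not_norm_leE)
  define y where "y i = (\<Sum>j<n. F i j * v j)" for i
  define l \<beta> where "l = L2_set (\<lambda>i. cmod (y i)) {..<n}" and "\<beta> = Re (sesq n F v v)"
  have l: "w < l" using v by (simp add: l_def y_def)
  have l2: "l\<^sup>2 = (\<Sum>i<n. (cmod (y i))\<^sup>2)" by (simp add: l_def L2_set_def sum_nonneg)
  have "sesq n F y v = of_real (l\<^sup>2)"
    unfolding l2 of_real_sum
    unfolding sesq_def y_def[symmetric] complex_norm_square by (simp add: mult.commute)
  then have "(l\<^sup>2)\<^sup>2 \<le> Re (sesq n F v v) * Re (sesq n F y y)"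
    using psd_Cauchy_Schwarz[OF F, of y v] by (simp add: norm_power)
  moreover have "\<beta> \<ge> 0" using F by (simp add: psd_def \<beta>_def)
  \<comment> \<open>\<beta> = 0 would force l^4 to be at most 0, although l > w > 0.\<close>
  ultimately have \<beta>0: "\<beta> > 0"
    using l assms(2) by (cases "\<beta> = 0") (auto simp: \<beta>_def)
  have "\<beta> \<le> cmod (sesq n F v v)" by (simp add: \<beta>_def complex_Re_le_cmod)
  also have "\<dots> \<le> (\<Sum>i<n. \<bar>cmod (v i)\<bar> * \<bar>cmod (y i)\<bar>)"
    unfolding sesq_def y_def[symmetric] by (rule order_trans[OF norm_sum]) (simp add: norm_mult)
  also have "\<dots> \<le> L2_set (\<lambda>i. cmod (v i)) {..<n} * l"
    unfolding l_def by (rule L2_set_mult_ineq)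
  also have "\<dots> = l" using v(1) by (simp add: L2_set_def)
  finally have "\<beta> \<le> l" .
  then have "l * \<beta> \<le> l\<^sup>2"
    using l assms(2) by (simp add: power2_eq_square)
  then have "l \<le> l\<^sup>2 / \<beta>" using \<beta>0 by (simp add: pos_le_divide_eq)
  then have "w \<le> l\<^sup>2 / \<beta>" using l by simp
  moreover have "(\<Sum>i<n. Re (F i i - y i * (cnj (y i) / of_real \<beta>))) = (\<Sum>i<n. Re (F i i)) - l\<^sup>2 / \<beta>"
  proof -
    have "Re (F i i - y i * (cnj (y i) / of_real \<beta>)) = Re (F i i) - (cmod (y i))\<^sup>2 / \<beta>" for i
    proof -
      have "y i * (cnj (y i) / of_real \<beta>) = of_real ((cmod (y i))\<^sup>2 / \<beta>)"
        unfolding of_real_divide complex_norm_square by simp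
      then show ?thesis by (simp only: minus_complex.simps Re_complex_of_real)
    qed
    then show ?thesis unfolding l2 sum_divide_distrib by (simp only: sum_subtractf)
  qed
  moreover have "psd n (\<lambda>i j. F i j - y i * (cnj (y j) / of_real \<beta>))"
    by (rule psd_deflate[OF F y_def \<beta>_def \<beta>0])
  ultimately show "\<exists>u v. psd n (\<lambda>i j. F i j - u i * v j) \<and>
      (\<Sum>i<n. Re (F i i - u i * v i)) \<le> (\<Sum>i<n. Re (F i i)) - w"
    by (intro exI[of _ y] exI[of _ "\<lambda>j. cnj (y j) / of_real \<beta>"]) simp
qed (use assms psd_diag_nonneg in \<open>auto intro!: sum_nonneg\<close>)

text \<open>With e the k-th unit vector and y = F e, Cauchy-Schwarz gives |y|^4 = |y^H F e|^2 \<le>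
  (e^H F e) (y^H F y) \<le> M (M |y|^2). Applied to Toeplitz matrices, this replaces Bessel's
  inequality.\<close>

lemma psd_column_bound:
  assumes F: "psd n F" and bd: "\<And>u. Re (sesq n F u u) \<le> M * (\<Sum>i<n. (cmod (u i))\<^sup>2)" and k: "k < n"
  shows "(\<Sum>i<n. (cmod (F i k))\<^sup>2) \<le> M\<^sup>2"
proof -
  define e :: "nat \<Rightarrow> complex" where "e = (\<lambda>j. if j = k then 1 else 0)"
  define Y where "Y = (\<Sum>i<n. (cmod (F i k))\<^sup>2)"
  have Y0: "Y \<ge> 0" by (simp add: Y_def sum_nonneg)
  have "(\<Sum>i<n. (cmod (e i))\<^sup>2) = 1"
    using k by (simp add: e_def if_distrib[of cmod] if_distribR if_distrib[of "\<lambda>x. x\<^sup>2"] sum.delta cong: if_cong)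
  then have "Re (sesq n F e e) \<le> M" using bd[of e] by simp
  moreover have "Re (sesq n F (\<lambda>i. F i k) (\<lambda>i. F i k)) \<le> M * Y" using bd by (simp add: Y_def)
  moreover have "sesq n F (\<lambda>i. F i k) e = of_real Y"
    unfolding e_def sesq_unit[OF k] Y_def of_real_sum
    by (simp add: complex_norm_square mult.commute del: of_real_power)
  then have "Y\<^sup>2 \<le> Re (sesq n F e e) * Re (sesq n F (\<lambda>i. F i k) (\<lambda>i. F i k))"
    using psd_Cauchy_Schwarz[OF F, of "\<lambda>i. F i k" e] Y0 by simp
  moreover have "0 \<le> Re (sesq n F e e)" "0 \<le> Re (sesq n F (\<lambda>i. F i k) (\<lambda>i. F i k))"
    using F by (auto simp: psd_def)
  ultimately have "Y\<^sup>2 \<le> M * (M * Y)"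
    using mult_mono[of "Re (sesq n F e e)" M "Re (sesq n F (\<lambda>i. F i k) (\<lambda>i. F i k))" "M * Y"] by linarith
  then have "Y * Y \<le> M\<^sup>2 * Y" by (simp add: power2_eq_square mult_ac)
  then have "Y \<le> M\<^sup>2" using Y0 by (cases "Y = 0") auto
  then show ?thesis by (simp add: Y_def)
qed

section \<open>Scalar Toeplitz matrices\<close>

text \<open>Scalar counterpart of \<open>fourier_coeff\<close>: the entries of
  \<open>fourier_coeff s t f k\<close> are the \<open>fcoeff\<close> of the entries of
  \<open>f\<close>.\<close>

definition fcoeff :: "(real \<Rightarrow> complex) \<Rightarrow> int \<Rightarrow> complex" where
  "fcoeff h k = 1 / (2 * of_real pi) *
     (LINT \<theta>|lebesgue_on {-pi..pi}. h \<theta> * exp (- \<i> * of_int k * of_real \<theta>))"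

lemma integrable_mult_continuous:
  fixes h g :: "real \<Rightarrow> complex"
  assumes "integrable (lebesgue_on {-pi..pi}) h" "continuous_on {-pi..pi} g"
  shows "integrable (lebesgue_on {-pi..pi}) (\<lambda>\<theta>. h \<theta> * g \<theta>)"
proof -
  have "compact (g ` {-pi..pi})" by (intro compact_continuous_image assms) auto
  then obtain B where B: "\<forall>\<theta>\<in>{-pi..pi}. cmod (g \<theta>) \<le> B"
    by (metis bounded_iff compact_imp_bounded imageI)
  have g: "g \<in> borel_measurable (lebesgue_on {-pi..pi})"
    by (intro continuous_imp_measurable_on_sets_lebesgue assms) auto
  show ?thesis
  proof (rule Bochner_Integration.integrable_bound[of _ "\<lambda>\<theta>. of_real B * h \<theta>"])
    show "integrable (lebesgue_on {-pi..pi}) (\<lambda>\<theta>. of_real B * h \<theta>)" using assms(1) by simp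
    show "(\<lambda>\<theta>. h \<theta> * g \<theta>) \<in> borel_measurable (lebesgue_on {-pi..pi})"
      using g borel_measurable_integrable[OF assms(1)] by (rule borel_measurable_times[rotated])
    show "AE \<theta> in lebesgue_on {-pi..pi}. cmod (h \<theta> * g \<theta>) \<le> cmod (of_real B * h \<theta>)"
    proof (rule AE_I2)
      fix \<theta> assume "\<theta> \<in> space (lebesgue_on {-pi..pi})"
      then have "cmod (g \<theta>) \<le> B" using B by simp
      then have "cmod (g \<theta>) \<le> \<bar>B\<bar>" by linarith
      then have "cmod (g \<theta>) * cmod (h \<theta>) \<le> \<bar>B\<bar> * cmod (h \<theta>)" by (rule mult_right_mono) simp
      then show "cmod (h \<theta> * g \<theta>) \<le> cmod (of_real B * h \<theta>)" by (simp add: norm_mult mult.commute)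
    qed
  qed
qed

lemma integrable_mult_exp:
  "integrable (lebesgue_on {-pi..pi}) h \<Longrightarrow>
    integrable (lebesgue_on {-pi..pi}) (\<lambda>\<theta>. h \<theta> * exp (- \<i> * of_int k * of_real \<theta>))"
  by (intro integrable_mult_continuous continuous_intros)

lemma fcoeff_add:
  assumes "integrable (lebesgue_on {-pi..pi}) g" "integrable (lebesgue_on {-pi..pi}) h"
  shows "fcoeff (\<lambda>\<theta>. g \<theta> + h \<theta>) k = fcoeff g k + fcoeff h k"
  using assms[THEN integrable_mult_exp, of k]
  by (simp add: fcoeff_def distrib_right distrib_left add_divide_distrib)

lemma fcoeff_cmult: "fcoeff (\<lambda>\<theta>. c * h \<theta>) k = c * fcoeff h k"
  by (simp add: fcoeff_def mult.assoc)

lemma fcoeff_const: "fcoeff (\<lambda>_. c) k = (if k = 0 then c else 0)"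
proof (cases "k = 0")
  case True
  have "(LINT \<theta>|lebesgue_on {-pi..pi}. c) = 2 * of_real pi * c"
    by (simp add: measure_restrict_space scaleR_conv_of_real)
  then show ?thesis using True by (simp add: fcoeff_def)
next
  case False
  define K where "K = - \<i> * of_int k"
  have K: "K \<noteq> 0" using False by (simp add: K_def)
  have "((\<lambda>\<theta>. exp (K * of_real \<theta>)) has_integral
      (exp (K * of_real pi) / K - exp (K * of_real (- pi)) / K)) {-pi..pi}"
  proof (rule fundamental_theorem_of_calculus)
    fix \<theta> :: real
    have "((\<lambda>z. exp (K * z) / K) has_field_derivative exp (K * of_real \<theta>)) (at (of_real \<theta>))"
      using K by (auto intro!: derivative_eq_intros)
    then show "((\<lambda>\<theta>. exp (K * of_real \<theta>) / K) has_vector_derivative exp (K * of_real \<theta>)) (at \<theta> within {-pi..pi})"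
      by (rule has_vector_derivative_at_within[OF has_vector_derivative_real_field])
  qed simp
  moreover have "exp (K * of_real pi) = exp (K * of_real (- pi))"
  proof -
    have "K * of_real pi = K * of_real (- pi) + of_int (2 * (- k)) * of_real pi * \<i>"
      by (simp add: K_def algebra_simps)
    then show ?thesis unfolding exp_eq by (intro exI[of _ "- k"]) simp
  qed
  ultimately have "((\<lambda>\<theta>. exp (K * of_real \<theta>)) has_integral 0) {-pi..pi}" by simp
  then have "integral {-pi..pi} (\<lambda>\<theta>. exp (K * of_real \<theta>)) = 0" by (rule integral_unique)
  moreover have "integrable (lebesgue_on {-pi..pi}) (\<lambda>\<theta>. exp (K * of_real \<theta>))"
    using integrable_mult_exp[of "\<lambda>_. 1" k] by (simp add: K_def)
  ultimately have "(LINT \<theta>|lebesgue_on {-pi..pi}. exp (K * of_real \<theta>)) = 0"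
    by (simp add: lebesgue_integral_eq_integral)
  then show ?thesis using False by (simp add: fcoeff_def K_def)
qed

lemma fcoeff_cnj: "fcoeff (\<lambda>\<theta>. of_real (h \<theta>)) (- k) = cnj (fcoeff (\<lambda>\<theta>. of_real (h \<theta>)) k)"
proof -
  have "cnj (LINT \<theta>|lebesgue_on {-pi..pi}. of_real (h \<theta>) * exp (- \<i> * of_int k * of_real \<theta>))
      = (LINT \<theta>|lebesgue_on {-pi..pi}. cnj (of_real (h \<theta>) * exp (- \<i> * of_int k * of_real \<theta>)))"
    by (rule Bochner_Integration.integral_cnj[symmetric])
  then show ?thesis by (simp add: fcoeff_def exp_cnj)
qed

text \<open>With the trigonometric polynomial p having coefficients v j, expanding |p|^2 into
  exponentials produces exactly the coefficients of index i - j. Through this formula pointwise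
  bounds on h become bounds on the form of T(h).\<close>

lemma sesq_toeplitz:
  assumes h: "integrable (lebesgue_on {-pi..pi}) h"
  shows "sesq n (\<lambda>i j. fcoeff h (int i - int j)) v v = 1 / (2 * of_real pi) *
    (LINT \<theta>|lebesgue_on {-pi..pi}. h \<theta> * of_real ((cmod (\<Sum>j<n. v j * exp (\<i> * of_nat j * of_real \<theta>)))\<^sup>2))"
proof -
  let ?e = "\<lambda>\<theta> i j. exp (- \<i> * of_int (int i - int j) * complex_of_real \<theta>)"
  have "h \<theta> * of_real ((cmod (\<Sum>j<n. v j * exp (\<i> * of_nat j * of_real \<theta>)))\<^sup>2)
      = (\<Sum>i<n. \<Sum>j<n. cnj (v i) * v j * (h \<theta> * ?e \<theta> i j))" for \<theta>
  proof -
    have e: "?e \<theta> i j = cnj (exp (\<i> * of_nat i * of_real \<theta>)) * exp (\<i> * of_nat j * of_real \<theta>)" for i j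
      by (simp add: exp_cnj algebra_simps flip: exp_add)
    have "of_real ((cmod (\<Sum>j<n. v j * exp (\<i> * of_nat j * of_real \<theta>)))\<^sup>2)
       = (\<Sum>i<n. cnj (v i * exp (\<i> * of_nat i * of_real \<theta>))) * (\<Sum>j<n. v j * exp (\<i> * of_nat j * of_real \<theta>))"
      by (subst complex_norm_square) (simp add: mult.commute)
    then show ?thesis
      unfolding e by (simp add: sum_distrib_left sum_product mult_ac)
  qed
  then have "(LINT \<theta>|lebesgue_on {-pi..pi}. h \<theta> * of_real ((cmod (\<Sum>j<n. v j * exp (\<i> * of_nat j * of_real \<theta>)))\<^sup>2))
      = (LINT \<theta>|lebesgue_on {-pi..pi}. (\<Sum>i<n. \<Sum>j<n. cnj (v i) * v j * (h \<theta> * ?e \<theta> i j)))" by simp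
  also have "\<dots> = (\<Sum>i<n. LINT \<theta>|lebesgue_on {-pi..pi}. (\<Sum>j<n. cnj (v i) * v j * (h \<theta> * ?e \<theta> i j)))"
    by (intro Bochner_Integration.integral_sum Bochner_Integration.integrable_sum
        integrable_mult_right integrable_mult_exp h)
  also have "\<dots> = (\<Sum>i<n. \<Sum>j<n. LINT \<theta>|lebesgue_on {-pi..pi}. cnj (v i) * v j * (h \<theta> * ?e \<theta> i j))"
    by (intro sum.cong refl Bochner_Integration.integral_sum integrable_mult_right integrable_mult_exp h)
  also have "\<dots> = (\<Sum>i<n. \<Sum>j<n. cnj (v i) * v j * (LINT \<theta>|lebesgue_on {-pi..pi}. h \<theta> * ?e \<theta> i j))"
    by (simp only: integral_mult_right_zero)
  finally show ?thesis
    by (simp add: sesq_def fcoeff_def sum_distrib_left mult_ac del: of_int_diff)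
qed

lemma Re_sesq_toeplitz:
  assumes h: "integrable (lebesgue_on {-pi..pi}) h"
  shows "Re (sesq n (\<lambda>i j. fcoeff (\<lambda>\<theta>. of_real (h \<theta>)) (int i - int j)) v v) = 1 / (2 * pi) *
    (LINT \<theta>|lebesgue_on {-pi..pi}. h \<theta> * (cmod (\<Sum>j<n. v j * exp (\<i> * of_nat j * of_real \<theta>)))\<^sup>2)"
proof -
  have "sesq n (\<lambda>i j. fcoeff (\<lambda>\<theta>. of_real (h \<theta>)) (int i - int j)) v v
     = 1 / (2 * of_real pi) * of_real (LINT \<theta>|lebesgue_on {-pi..pi}. h \<theta> *
         (cmod (\<Sum>j<n. v j * exp (\<i> * of_nat j * of_real \<theta>)))\<^sup>2)"
    using h by (subst sesq_toeplitz) (simp_all flip: of_real_mult of_real_power)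
  also have "\<dots> = of_real (1 / (2 * pi) * (LINT \<theta>|lebesgue_on {-pi..pi}. h \<theta> *
         (cmod (\<Sum>j<n. v j * exp (\<i> * of_nat j * of_real \<theta>)))\<^sup>2))" by simp
  finally show ?thesis by (simp only: Re_complex_of_real)
qed

lemma psd_toeplitz:
  assumes "integrable (lebesgue_on {-pi..pi}) h" "\<And>\<theta>. \<theta> \<in> {-pi..pi} \<Longrightarrow> 0 \<le> h \<theta>"
  shows "psd n (\<lambda>i j. fcoeff (\<lambda>\<theta>. of_real (h \<theta>)) (int i - int j))"
proof -
  have "cnj (fcoeff (\<lambda>\<theta>. of_real (h \<theta>)) (int i - int j)) = fcoeff (\<lambda>\<theta>. of_real (h \<theta>)) (int j - int i)" for i j
    using fcoeff_cnj[of h "int i - int j"] by simp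
  moreover have "0 \<le> Re (sesq n (\<lambda>i j. fcoeff (\<lambda>\<theta>. of_real (h \<theta>)) (int i - int j)) v v)" for v
    unfolding Re_sesq_toeplitz[OF assms(1)]
    by (intro mult_nonneg_nonneg Bochner_Integration.integral_nonneg) (auto simp: assms(2))
  ultimately show ?thesis by (simp add: psd_def)
qed

text \<open>Comparison with the constant symbol M, whose Toeplitz matrix is M times the identity;
  this evaluates the integral of M |p|^2 without a separate orthogonality computation.\<close>

lemma toeplitz_sesq_le:
  assumes "integrable (lebesgue_on {-pi..pi}) h" "\<And>\<theta>. \<theta> \<in> {-pi..pi} \<Longrightarrow> h \<theta> \<le> M"
  shows "Re (sesq n (\<lambda>i j. fcoeff (\<lambda>\<theta>. of_real (h \<theta>)) (int i - int j)) v v) \<le> M * (\<Sum>i<n. (cmod (v i))\<^sup>2)"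
proof -
  let ?p = "\<lambda>\<theta>. (cmod (\<Sum>j<n. v j * exp (\<i> * of_nat j * of_real \<theta>)))\<^sup>2"
  have int: "integrable (lebesgue_on {-pi..pi}) (\<lambda>\<theta>. g \<theta> * ?p \<theta>)"
    if "integrable (lebesgue_on {-pi..pi}) g" for g
  proof -
    have "integrable (lebesgue_on {-pi..pi}) (\<lambda>\<theta>. of_real (g \<theta>) * of_real (?p \<theta>) :: complex)"
      using that by (intro integrable_mult_continuous continuous_intros integrable_of_real)
    then have "integrable (lebesgue_on {-pi..pi}) (\<lambda>\<theta>. Re (of_real (g \<theta>) * of_real (?p \<theta>)))"
      by (rule integrable_Re)
    then show ?thesis by (simp del: of_real_power)
  qed
  have "Re (sesq n (\<lambda>i j. fcoeff (\<lambda>\<theta>. of_real (h \<theta>)) (int i - int j)) v v)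
      = 1 / (2 * pi) * (LINT \<theta>|lebesgue_on {-pi..pi}. h \<theta> * ?p \<theta>)"
    by (rule Re_sesq_toeplitz[OF assms(1)])
  also have "\<dots> \<le> 1 / (2 * pi) * (LINT \<theta>|lebesgue_on {-pi..pi}. M * ?p \<theta>)"
    by (intro mult_left_mono integral_mono int assms(1)) (auto intro!: mult_right_mono assms(2))
  also have "\<dots> = Re (sesq n (\<lambda>i j. fcoeff (\<lambda>\<theta>. of_real M) (int i - int j)) v v)"
    by (rule Re_sesq_toeplitz[symmetric]) simp
  also have "sesq n (\<lambda>i j. fcoeff (\<lambda>\<theta>. of_real M) (int i - int j)) v v
      = (\<Sum>i<n. of_real M * (v i * cnj (v i)))"
    unfolding sesq_def fcoeff_const
  proof (intro sum.cong refl)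
    fix i assume "i \<in> {..<n}"
    have "(\<Sum>j<n. (if int i - int j = 0 then complex_of_real M else 0) * v j)
        = (\<Sum>j<n. if i = j then of_real M * v j else 0)"
      by (intro sum.cong) auto
    also have "\<dots> = of_real M * v i" using \<open>i \<in> {..<n}\<close> by simp
    finally show "cnj (v i) * (\<Sum>j<n. (if int i - int j = 0 then complex_of_real M else 0) * v j)
        = of_real M * (v i * cnj (v i))" by simp
  qed
  also have "\<dots> = of_real (M * (\<Sum>i<n. (cmod (v i))\<^sup>2))"
    unfolding complex_norm_square[symmetric] by (simp add: sum_distrib_left)
  finally show ?thesis by (simp only: Re_complex_of_real)
qed

lemma summable_fcoeff_square:
  assumes "integrable (lebesgue_on {-pi..pi}) h" "\<And>\<theta>. \<theta> \<in> {-pi..pi} \<Longrightarrow> 0 \<le> h \<theta> \<and> h \<theta> \<le> M"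
  shows "summable (\<lambda>l. (cmod (fcoeff (\<lambda>\<theta>. of_real (h \<theta>)) (int l)))\<^sup>2)"
proof (rule summableI_nonneg_bounded)
  fix n
  show "(\<Sum>l<n. (cmod (fcoeff (\<lambda>\<theta>. of_real (h \<theta>)) (int l)))\<^sup>2) \<le> M\<^sup>2"
  proof (cases "n = 0")
    case False
    \<comment> \<open>Column 0 of the n by n Toeplitz matrix consists of the coefficients 0, ..., n
      - 1, and its bound does not depend on n.\<close>
    have "(\<Sum>l<n. (cmod (fcoeff (\<lambda>\<theta>. of_real (h \<theta>)) (int l - int 0)))\<^sup>2) \<le> M\<^sup>2"
      by (rule psd_column_bound[OF psd_toeplitz toeplitz_sesq_le]) (use assms False in auto)
    then show ?thesis by simp
  qed simp
qed simp

text \<open>All diagonal entries equal the mean of h, so the trace is n / (2 pi) times the integral;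
  the factor 1 / (2 pi) is discarded.\<close>

lemma splits_toeplitz:
  assumes "integrable (lebesgue_on {-pi..pi}) h" "\<And>\<theta>. \<theta> \<in> {-pi..pi} \<Longrightarrow> 0 \<le> h \<theta>" "w > 0"
  shows "splits n n (real n * (LINT \<theta>|lebesgue_on {-pi..pi}. h \<theta>) / w) w
    (\<lambda>i j. fcoeff (\<lambda>\<theta>. of_real (h \<theta>)) (int i - int j))"
proof -
  let ?I = "LINT \<theta>|lebesgue_on {-pi..pi}. h \<theta>"
  have "fcoeff (\<lambda>\<theta>. of_real (h \<theta>)) 0 = of_real (?I / (2 * pi))" by (simp add: fcoeff_def)
  then have eq: "(\<Sum>i<n. Re (fcoeff (\<lambda>\<theta>. of_real (h \<theta>)) (int i - int i))) = real n * (?I / (2 * pi))"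
    by (simp only: diff_self Re_complex_of_real sum_constant card_lessThan)
  have le: "?I / (2 * pi) \<le> ?I"
  proof -
    have "?I * 1 \<le> ?I * (2 * pi)"
      using pi_gt3 assms(2) by (intro mult_left_mono Bochner_Integration.integral_nonneg) auto
    then show ?thesis by (simp add: pos_divide_le_eq)
  qed
  have "(\<Sum>i<n. Re (fcoeff (\<lambda>\<theta>. of_real (h \<theta>)) (int i - int i))) / w \<le> real n * ?I / w"
    unfolding eq by (intro divide_right_mono mult_left_mono le) (use assms(3) in simp_all)
  with splits_psd[OF psd_toeplitz[OF assms(1,2), of n] assms(3)] show ?thesis
    by (rule splits_mono) simp_all
qed

text \<open>Dominated convergence with majorant h: at every point the excess over m vanishes as soon
  as m reaches the value of h.\<close>

lemma truncation_small:
  fixes h :: "'a \<Rightarrow> real"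
  assumes "integrable M h" "\<And>x. x \<in> space M \<Longrightarrow> 0 \<le> h x" "\<epsilon> > 0"
  obtains m :: nat where "(LINT x|M. h x - min (h x) (real m)) < \<epsilon>"
proof -
  have "(\<lambda>m. LINT x|M. h x - min (h x) (real m)) \<longlonglongrightarrow> (LINT x|M. 0)"
  proof (rule integral_dominated_convergence[where w = h])
    show "AE x in M. (\<lambda>m. h x - min (h x) (real m)) \<longlonglongrightarrow> 0"
    proof (rule AE_I2)
      fix x
      have "\<forall>\<^sub>F m in sequentially. h x - min (h x) (real m) = 0"
        using eventually_ge_at_top[of "nat \<lceil>h x\<rceil>"] by eventually_elim linarith
      then show "(\<lambda>m. h x - min (h x) (real m)) \<longlonglongrightarrow> 0" by (rule tendsto_eventually)
    qed
    show "AE x in M. norm (h x - min (h x) (real m)) \<le> h x" for m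
      using assms(2) by (intro AE_I2) (auto simp: min_def)
  qed (use assms(1) in auto)
  then have "\<forall>\<^sub>F m in sequentially. (LINT x|M. h x - min (h x) (real m)) < \<epsilon>"
    using order_tendstoD(2)[of _ 0 _ \<epsilon>] assms(3) by simp
  then show ?thesis using that eventually_happens'[OF sequentially_bot] by blast
qed

section \<open>The part outside the diagonal blocks\<close>

text \<open>Number, counted from 0, of the diagonal block containing the block row or column
  \<open>i\<close>. Positions past the end of the list all receive \<open>length ns\<close>, as if
  they formed one more block.\<close>

fun blk :: "nat list \<Rightarrow> nat \<Rightarrow> nat" where
  "blk [] i = 0"
| "blk (n # ns) i = (if i < n then 0 else Suc (blk ns (i - n)))"

lemma blk_less: "i < sum_list ns \<Longrightarrow> blk ns i < length ns"
  by (induction ns i rule: blk.induct) auto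

definition offd :: "nat \<Rightarrow> nat \<Rightarrow> nat list \<Rightarrow> (nat \<Rightarrow> nat \<Rightarrow> complex) \<Rightarrow> nat \<Rightarrow> nat \<Rightarrow> complex" where
  "offd s t ns F i j = (if blk ns (i div s) = blk ns (j div t) then 0 else F i j)"

text \<open>Turns the combinatorial condition of lying in different blocks into proximity to one of
  only \<open>length ns\<close> boundaries, so that it can be combined with decay in the distance i
  - j.\<close>

lemma blk_neq_boundary:
  "i < j \<Longrightarrow> blk ns i \<noteq> blk ns j \<Longrightarrow>
    \<exists>k<length ns. i < sum_list (take (Suc k) ns) \<and> sum_list (take (Suc k) ns) \<le> j"
proof (induction ns arbitrary: i j)
  case (Cons n ns)
  show ?case
  proof (cases "i < n")
    case True
    then have "n \<le> j" using Cons.prems by (auto split: if_splits)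
    then show ?thesis using True by (intro exI[of _ 0]) simp
  next
    case False
    then have "i - n < j - n" "blk ns (i - n) \<noteq> blk ns (j - n)"
      using Cons.prems by (auto split: if_splits)
    then obtain k where "k < length ns" "i - n < sum_list (take (Suc k) ns)" "sum_list (take (Suc k) ns) \<le> j - n"
      using Cons.IH by blast
    then show ?thesis using False Cons.prems(1) by (intro exI[of _ "Suc k"]) auto
  qed
qed simp

text \<open>The block diagonal part is the sum of the compressions P F Q over the blocks, with
  indicator matrices P and Q. Adding the norms is crude but costs only the factor
  \<open>length ns\<close>.\<close>

lemma splits_block_diagonal:
  assumes "splits (d * s) (d * t) r w F" "w \<ge> 0" "sum_list ns = d"
  shows "splits (d * s) (d * t) (real (length ns) * r) (real (length ns) * w)
    (\<lambda>i j. if blk ns (i div s) = blk ns (j div t) then F i j else 0)"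
proof -
  let ?\<alpha> = "\<lambda>k i. if blk ns (i div s) = k then 1 else (0 :: complex)"
  let ?\<beta> = "\<lambda>k j. if blk ns (j div t) = k then 1 else (0 :: complex)"
  have "splits (d * s) (d * t) r (1 * w) (\<lambda>i j. ?\<alpha> k i * F i j * ?\<beta> k j)" for k
    by (rule splits_mask[OF assms(1,2)]) auto
  then have "splits (d * s) (d * t) (\<Sum>k<length ns. r) (\<Sum>k<length ns. 1 * w)
      (\<lambda>i j. \<Sum>k<length ns. ?\<alpha> k i * F i j * ?\<beta> k j)"
    by (intro splits_sum) auto
  then show ?thesis
  proof (rule splits_cong[OF splits_mono])
    fix i j assume "i < d * s" "j < d * t"
    then have "blk ns (i div s) < length ns"
      using assms(3) by (intro blk_less) (auto simp: less_mult_imp_div_less)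
    moreover have "(\<Sum>k<length ns. ?\<alpha> k i * F i j * ?\<beta> k j)
        = (\<Sum>k<length ns. if blk ns (i div s) = k then
            (if blk ns (i div s) = blk ns (j div t) then F i j else 0) else 0)"
      by (intro sum.cong) auto
    ultimately show "(\<Sum>k<length ns. ?\<alpha> k i * F i j * ?\<beta> k j)
        = (if blk ns (i div s) = blk ns (j div t) then F i j else 0)"
      by simp
  qed simp_all
qed

lemma splits_offd:
  assumes "splits (d * s) (d * t) r w F" "w \<ge> 0" "sum_list ns = d"
  shows "splits (d * s) (d * t) ((real (length ns) + 1) * r) ((real (length ns) + 1) * w) (offd s t ns F)"
proof -
  have "splits (d * s) (d * t) (real (length ns) * r) (1 * (real (length ns) * w))
    (\<lambda>i j. -1 * (if blk ns (i div s) = blk ns (j div t) then F i j else 0) * 1)"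
    by (rule splits_mask[OF splits_block_diagonal[OF assms]]) (use assms in simp_all)
  from splits_add[OF assms(1) this] show ?thesis
    by (rule splits_cong[OF splits_mono]) (auto simp: offd_def algebra_simps)
qed

text \<open>On each side of the diagonal every distance occurs at most once in row i, so each half
  is dominated by the tail of the series from K on, uniformly in i and d.\<close>

lemma sum_square_tail_le:
  fixes c :: "int \<Rightarrow> complex"
  assumes sym: "\<And>k. cmod (c (- k)) = cmod (c k)" and sm: "summable (\<lambda>l. (cmod (c (int l)))\<^sup>2)"
  shows "(\<Sum>j<d. if i + K \<le> j \<or> j + K \<le> i then (cmod (c (int i - int j)))\<^sup>2 else 0)
    \<le> 2 * (\<Sum>l. (cmod (c (int (l + K))))\<^sup>2)"
proof -
  let ?g = "\<lambda>l. (cmod (c (int l)))\<^sup>2"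
  have sm': "summable (\<lambda>l. ?g (l + K))" using summable_iff_shift[of ?g K] sm by blast
  have half: "(\<Sum>j\<in>A. ?g (\<phi> j + K)) \<le> (\<Sum>l. ?g (l + K))" if "finite A" "inj_on \<phi> A" for A :: "nat set" and \<phi>
  proof -
    have "(\<Sum>j\<in>A. ?g (\<phi> j + K)) = (\<Sum>l\<in>\<phi> ` A. ?g (l + K))"
      by (simp add: sum.reindex[OF that(2)])
    also have "\<dots> \<le> (\<Sum>l. ?g (l + K))" by (rule sum_le_suminf[OF sm']) (use that in auto)
    finally show ?thesis .
  qed
  \<comment> \<open>For K = 0 the index j = i lies in both halves, whence only an
    inequality.\<close>
  have "(\<Sum>j<d. if i + K \<le> j \<or> j + K \<le> i then (cmod (c (int i - int j)))\<^sup>2 else 0)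
      \<le> (\<Sum>j<d. (if j + K \<le> i then (cmod (c (int i - int j)))\<^sup>2 else 0)
        + (if i + K \<le> j then (cmod (c (int i - int j)))\<^sup>2 else 0))"
    by (intro sum_mono) auto
  also have "\<dots> = (\<Sum>j\<in>{j\<in>{..<d}. j + K \<le> i}. (cmod (c (int i - int j)))\<^sup>2)
      + (\<Sum>j\<in>{j\<in>{..<d}. i + K \<le> j}. (cmod (c (int i - int j)))\<^sup>2)"
    unfolding sum.distrib by (intro arg_cong2[of _ _ _ _ "(+)"] sum.inter_filter[symmetric]) auto
  also have "(\<Sum>j\<in>{j\<in>{..<d}. j + K \<le> i}. (cmod (c (int i - int j)))\<^sup>2)
      = (\<Sum>j\<in>{j\<in>{..<d}. j + K \<le> i}. ?g ((i - j - K) + K))"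
    by (intro sum.cong refl) (auto simp: of_nat_diff)
  also have "\<dots> \<le> (\<Sum>l. ?g (l + K))" by (rule half) (auto simp: inj_on_def)
  also have "(\<Sum>j\<in>{j\<in>{..<d}. i + K \<le> j}. (cmod (c (int i - int j)))\<^sup>2)
      = (\<Sum>j\<in>{j\<in>{..<d}. i + K \<le> j}. ?g ((j - i - K) + K))"
  proof (intro sum.cong refl)
    fix j assume "j \<in> {j\<in>{..<d}. i + K \<le> j}"
    then have "int i - int j = - int ((j - i - K) + K)" by simp
    then show "(cmod (c (int i - int j)))\<^sup>2 = ?g ((j - i - K) + K)" by (simp only: sym)
  qed
  also have "\<dots> \<le> (\<Sum>l. ?g (l + K))" by (rule half) (auto simp: inj_on_def)
  finally show ?thesis by simp
qed

text \<open>The rows at distance at least \<open>K\<close> from all block boundaries only meet the tail of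
  the square-summable coefficients; there are at most \<open>2 * K * length ns\<close> other rows.\<close>

lemma offd_frobenius_small:
  fixes c :: "int \<Rightarrow> complex"
  assumes sym: "\<And>k. cmod (c (- k)) = cmod (c k)" and sm: "summable (\<lambda>l. (cmod (c (int l)))\<^sup>2)"
    and "\<epsilon> > 0"
  obtains D where "\<And>d ns. d \<ge> D \<Longrightarrow> length ns = \<nu> \<Longrightarrow>
    (\<Sum>i<d. \<Sum>j<d. (cmod (offd 1 1 ns (\<lambda>i j. c (int i - int j)) i j))\<^sup>2) \<le> \<epsilon> * real d"
proof -
  define C where "C = (\<Sum>l. (cmod (c (int l)))\<^sup>2)"
  have C: "C \<ge> 0" unfolding C_def by (rule suminf_nonneg[OF sm]) simp
  \<comment> \<open>A row far from the boundaries costs at most twice this tail, so all far rows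
    together stay below half of \<epsilon> d.\<close>
  obtain K where K: "(\<Sum>l. (cmod (c (int (l + K))))\<^sup>2) < \<epsilon> / 4"
    using suminf_exist_split[OF _ sm, of "\<epsilon> / 4"] \<open>\<epsilon> > 0\<close> by (metis abs_ge_self divide_pos_pos order.refl order_le_less_trans real_norm_def zero_less_numeral)
  define T where "T = (\<Sum>l. (cmod (c (int (l + K))))\<^sup>2)"
  \<comment> \<open>The at most 2 \<nu> K near rows cost at most 2 C each; D makes the total 4 \<nu>
    K C at most the other half of \<epsilon> d.\<close>
  define D where "D = nat \<lceil>8 * real \<nu> * real K * C / \<epsilon>\<rceil>"
  show ?thesis
  proof (rule that[of D])
    fix d and ns :: "nat list" assume d: "d \<ge> D" and ns: "length ns = \<nu>"
    let ?o = "offd 1 1 ns (\<lambda>i j. c (int i - int j))"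
    define b where "b k = sum_list (take (Suc k) ns)" for k
    \<comment> \<open>Truncated subtraction merely cuts an interval at 0; its length is still at
      most 2 K.\<close>
    define near where "near = (\<Union>k<\<nu>. {b k - K..<b k + K})"
    have "card near \<le> (\<Sum>k<\<nu>. card {b k - K..<b k + K})"
      unfolding near_def by (rule card_UN_le) simp
    also have "\<dots> \<le> (\<Sum>k<\<nu>. 2 * K)" by (intro sum_mono) simp
    finally have card_near: "card near \<le> 2 * \<nu> * K" by simp
    have fin: "finite near" by (simp add: near_def)
    have row: "(\<Sum>j<d. (cmod (?o i j))\<^sup>2) \<le> (if i \<in> near then 2 * C else 0) + 2 * T" for i
    proof -
      have T0: "T \<ge> 0" unfolding T_def
        by (rule suminf_nonneg[OF summable_iff_shift[of "\<lambda>l. (cmod (c (int l)))\<^sup>2", THEN iffD2, OF sm]]) simp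
      have "(\<Sum>j<d. (cmod (?o i j))\<^sup>2) \<le>
          (\<Sum>j<d. if i + 0 \<le> j \<or> j + 0 \<le> i then (cmod (c (int i - int j)))\<^sup>2 else 0)"
        by (intro sum_mono) (auto simp: offd_def)
      also have "\<dots> \<le> 2 * C"
        using sum_square_tail_le[OF sym sm, where K = 0] by (simp add: C_def)
      finally have 1: "(\<Sum>j<d. (cmod (?o i j))\<^sup>2) \<le> 2 * C" .
      have 2: "(\<Sum>j<d. (cmod (?o i j))\<^sup>2) \<le> 2 * T" if "i \<notin> near"
      proof -
        have far: "i + K \<le> j \<or> j + K \<le> i" if neq: "blk ns i \<noteq> blk ns j" for j
        proof (cases "i < j")
          case True
          then obtain k where "k < \<nu>" "i < b k" "b k \<le> j"
            using blk_neq_boundary[OF True neq] ns by (auto simp: b_def)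
          moreover from \<open>k < \<nu>\<close> \<open>i \<notin> near\<close> have "i \<notin> {b k - K..<b k + K}" by (auto simp: near_def)
          ultimately show ?thesis by (simp add: not_le not_less; linarith)
        next
          case False
          then have "j < i" using neq by (cases "i = j") auto
          then obtain k where "k < \<nu>" "j < b k" "b k \<le> i"
            using blk_neq_boundary[OF \<open>j < i\<close> neq[symmetric]] ns by (auto simp: b_def)
          moreover from \<open>k < \<nu>\<close> \<open>i \<notin> near\<close> have "i \<notin> {b k - K..<b k + K}" by (auto simp: near_def)
          ultimately show ?thesis by (simp add: not_le not_less; linarith)
        qed
        have "(\<Sum>j<d. (cmod (?o i j))\<^sup>2) \<le>
          (\<Sum>j<d. if i + K \<le> j \<or> j + K \<le> i then (cmod (c (int i - int j)))\<^sup>2 else 0)"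
          using far by (intro sum_mono) (auto simp: offd_def)
        also have "\<dots> \<le> 2 * T" unfolding T_def by (rule sum_square_tail_le[OF sym sm])
        finally show ?thesis .
      qed
      show ?thesis using 1 2 T0 by auto
    qed
    have "(\<Sum>i<d. \<Sum>j<d. (cmod (?o i j))\<^sup>2) \<le> (\<Sum>i<d. (if i \<in> near then 2 * C else 0) + 2 * T)"
      by (intro sum_mono row)
    also have "\<dots> = real (card ({..<d} \<inter> near)) * (2 * C) + real d * (2 * T)"
      by (simp add: sum.distrib flip: sum.inter_restrict)
    also have "\<dots> \<le> real (2 * \<nu> * K) * (2 * C) + real d * (2 * (\<epsilon> / 4))"
    proof (intro add_mono mult_left_mono mult_right_mono)
      have "card ({..<d} \<inter> near) \<le> card near" using fin by (intro card_mono) auto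
      then show "real (card ({..<d} \<inter> near)) \<le> real (2 * \<nu> * K)" using card_near by linarith
    qed (use K C in \<open>auto simp: T_def\<close>)
    also have "real (2 * \<nu> * K) * (2 * C) \<le> \<epsilon> / 2 * real d"
    proof -
      have "8 * real \<nu> * real K * C / \<epsilon> \<le> real d" using d unfolding D_def by linarith
      then show ?thesis using \<open>\<epsilon> > 0\<close> by (simp add: pos_divide_le_eq mult_ac)
    qed
    finally show "(\<Sum>i<d. \<Sum>j<d. (cmod (?o i j))\<^sup>2) \<le> \<epsilon> * real d" by simp
  qed
qed

section \<open>Matrix families that are negligible outside the diagonal blocks\<close>

text \<open>The threshold D precedes the quantifier over \<open>ns\<close>: the partition may change
  arbitrarily with n, and the smallness must not depend on it. One \<epsilon> controls both the
  relative rank and the norm.\<close>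

definition negligible_offd :: "nat \<Rightarrow> nat \<Rightarrow> nat \<Rightarrow> (nat \<Rightarrow> nat \<Rightarrow> nat \<Rightarrow> complex) \<Rightarrow> bool" where
  "negligible_offd \<nu> s t F \<longleftrightarrow> (\<forall>\<epsilon>>0. \<exists>D. \<forall>d\<ge>D. \<forall>ns. length ns = \<nu> \<longrightarrow> sum_list ns = d \<longrightarrow>
     splits (d * s) (d * t) (\<epsilon> * real d) \<epsilon> (offd s t ns (F d)))"

lemma negligible_offd_cong:
  assumes "negligible_offd \<nu> s t F" "\<And>d i j. i < d * s \<Longrightarrow> j < d * t \<Longrightarrow> F d i j = G d i j"
  shows "negligible_offd \<nu> s t G"
  unfolding negligible_offd_def
proof (intro allI impI)
  fix \<epsilon> :: real assume "\<epsilon> > 0"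
  then obtain D where D: "\<And>d ns. d \<ge> D \<Longrightarrow> length ns = \<nu> \<Longrightarrow> sum_list ns = d \<Longrightarrow>
     splits (d * s) (d * t) (\<epsilon> * real d) \<epsilon> (offd s t ns (F d))"
    using assms(1) unfolding negligible_offd_def by blast
  show "\<exists>D. \<forall>d\<ge>D. \<forall>ns. length ns = \<nu> \<longrightarrow> sum_list ns = d \<longrightarrow>
     splits (d * s) (d * t) (\<epsilon> * real d) \<epsilon> (offd s t ns (G d))"
    by (intro exI[of _ D] allI impI, rule splits_cong[OF D]) (auto simp: offd_def assms(2))
qed

lemma negligible_offd_zero: "negligible_offd \<nu> s t (\<lambda>d i j. 0)"
  unfolding negligible_offd_def offd_def by (auto intro!: splits_zero)

lemma negligible_offd_add:
  assumes "negligible_offd \<nu> s t F" "negligible_offd \<nu> s t G"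
  shows "negligible_offd \<nu> s t (\<lambda>d i j. F d i j + G d i j)"
  unfolding negligible_offd_def
proof (intro allI impI)
  fix \<epsilon> :: real assume "\<epsilon> > 0"
  then have e: "\<epsilon> / 2 > 0" by simp
  obtain D where D: "\<And>d ns. d \<ge> D \<Longrightarrow> length ns = \<nu> \<Longrightarrow> sum_list ns = d \<Longrightarrow>
     splits (d * s) (d * t) (\<epsilon> / 2 * real d) (\<epsilon> / 2) (offd s t ns (F d))"
    using assms(1) e unfolding negligible_offd_def by blast
  obtain D' where D': "\<And>d ns. d \<ge> D' \<Longrightarrow> length ns = \<nu> \<Longrightarrow> sum_list ns = d \<Longrightarrow>
     splits (d * s) (d * t) (\<epsilon> / 2 * real d) (\<epsilon> / 2) (offd s t ns (G d))"
    using assms(2) e unfolding negligible_offd_def by blast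
  show "\<exists>D. \<forall>d\<ge>D. \<forall>ns. length ns = \<nu> \<longrightarrow> sum_list ns = d \<longrightarrow>
     splits (d * s) (d * t) (\<epsilon> * real d) \<epsilon> (offd s t ns (\<lambda>i j. F d i j + G d i j))"
    by (intro exI[of _ "max D D'"] allI impI, rule splits_cong[OF splits_mono[OF splits_add[OF D D']]])
      (auto simp: offd_def algebra_simps)
qed

lemma negligible_offd_sum:
  assumes "finite I" "\<And>x. x \<in> I \<Longrightarrow> negligible_offd \<nu> s t (F x)"
  shows "negligible_offd \<nu> s t (\<lambda>d i j. \<Sum>x\<in>I. F x d i j)"
  using assms by (induction I) (simp_all add: negligible_offd_zero negligible_offd_add)

text \<open>The multiplier may be unbounded, provided that few samples are large: the corresponding
  rows are absorbed into the part of low rank.\<close>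

lemma negligible_offd_row_mult:
  assumes F: "negligible_offd \<nu> s t F"
    and \<alpha>: "\<And>\<epsilon>::real. \<epsilon> > 0 \<Longrightarrow> \<exists>M D. \<forall>d\<ge>D. real (card {i. i < d \<and> M < cmod (\<alpha> d i)}) \<le> \<epsilon> * real d"
  shows "negligible_offd \<nu> s t (\<lambda>d i j. \<alpha> d (i div s) * F d i j)"
  unfolding negligible_offd_def
proof (intro allI impI)
  fix \<epsilon> :: real assume \<epsilon>: "\<epsilon> > 0"
  \<comment> \<open>Each large sample spoils s scalar rows, so at most \<delta> s d \<le> \<epsilon>
    / 2 d rows are lost; the + 1 keeps the quotient meaningful for s = 0.\<close>
  define \<delta> where "\<delta> = \<epsilon> / (2 * (real s + 1))"
  have \<delta>: "\<delta> > 0" using \<epsilon> by (simp add: \<delta>_def)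
  obtain M0 D where D: "\<And>d. d \<ge> D \<Longrightarrow> real (card {i. i < d \<and> M0 < cmod (\<alpha> d i)}) \<le> \<delta> * real d"
    using \<alpha>[OF \<delta>] by blast
  define M where "M = max M0 1"
  have M: "M \<ge> 1" "M \<ge> M0" by (simp_all add: M_def)
  \<comment> \<open>The bounded part of the multiplier scales the norm \<eta> to M \<eta> =
    \<epsilon> / 2. Since M is at least 1, also \<eta> \<le> \<epsilon> / 2, which is what the rank
    budget requires.\<close>
  define \<eta> where "\<eta> = \<epsilon> / (2 * M)"
  have \<eta>: "\<eta> > 0" using \<epsilon> M by (simp add: \<eta>_def)
  obtain D' where D': "\<And>d ns. d \<ge> D' \<Longrightarrow> length ns = \<nu> \<Longrightarrow> sum_list ns = d \<Longrightarrow>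
     splits (d * s) (d * t) (\<eta> * real d) \<eta> (offd s t ns (F d))"
    using F \<eta> unfolding negligible_offd_def by blast
  have "splits (d * s) (d * t) (\<epsilon> * real d) \<epsilon> (offd s t ns (\<lambda>i j. \<alpha> d (i div s) * F d i j))"
    if d: "d \<ge> max D D'" and ns: "length ns = \<nu>" "sum_list ns = d" for d ns
  proof -
    let ?o = "offd s t ns (F d)"
    define L where "L = {i. i < d \<and> M < cmod (\<alpha> d i)}"
    define T where "T = {i. i < d * s \<and> i div s \<in> L}"
    have finL: "finite L" by (simp add: L_def)
    have "T \<subseteq> (\<lambda>(i, r). i * s + r) ` (L \<times> {..<s})"
    proof
      fix i assume i: "i \<in> T"
      then have "s > 0" by (cases "s = 0") (auto simp: T_def)
      then show "i \<in> (\<lambda>(i, r). i * s + r) ` (L \<times> {..<s})"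
        using i by (intro image_eqI[of _ _ "(i div s, i mod s)"]) (auto simp: T_def)
    qed
    then have "card T \<le> card ((\<lambda>(i, r). i * s + r) ` (L \<times> {..<s}))"
      using finL by (intro card_mono) auto
    also have "\<dots> \<le> card (L \<times> {..<s})" using finL by (intro card_image_le) auto
    also have "\<dots> = card L * s" by (simp add: card_cartesian_product)
    finally have "card T \<le> card L * s" .
    moreover have "real (card L) \<le> \<delta> * real d"
    proof -
      have "card L \<le> card {i. i < d \<and> M0 < cmod (\<alpha> d i)}"
        unfolding L_def using M by (intro card_mono) auto
      then show ?thesis using D[of d] d by simp
    qed
    ultimately have "real (card T) \<le> \<delta> * real d * real s"
      by (metis (no_types, opaque_lifting) mult_right_mono of_nat_0_le_iff of_nat_le_iff of_nat_mult order_trans)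
    also have "\<dots> = \<delta> * real s * real d" by simp
    also have "\<dots> \<le> \<epsilon> / 2 * real d"
      using \<epsilon> by (intro mult_right_mono) (auto simp: \<delta>_def field_simps)
    finally have T: "real (card T) \<le> \<epsilon> / 2 * real d" .
    have 1: "splits (d * s) (d * t) (real (card T)) 0
        (\<lambda>i j. if i \<in> T then \<alpha> d (i div s) * ?o i j else 0)"
      by (rule splits_rows) (auto simp: T_def)
    have 2: "splits (d * s) (d * t) (\<eta> * real d) (M * \<eta>)
        (\<lambda>i j. (if M < cmod (\<alpha> d (i div s)) then 0 else \<alpha> d (i div s)) * ?o i j * 1)"
      by (rule splits_mask[OF D']) (use d ns \<eta> M in auto)
    have "\<eta> \<le> \<epsilon> / 2" using M \<epsilon> by (simp add: \<eta>_def field_simps)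
    then have r: "real (card T) + \<eta> * real d \<le> \<epsilon> * real d"
      using T mult_right_mono[of \<eta> "\<epsilon> / 2" "real d"] by simp
    have w: "0 + M * \<eta> \<le> \<epsilon>" using M \<epsilon> by (simp add: \<eta>_def)
    show ?thesis
    proof (rule splits_cong[OF splits_mono[OF splits_add[OF 1 2] r w]])
      fix i j assume "i < d * s" "j < d * t"
      then have "i \<in> T \<longleftrightarrow> M < cmod (\<alpha> d (i div s))"
        by (auto simp: T_def L_def less_mult_imp_div_less)
      then show "(if i \<in> T then \<alpha> d (i div s) * ?o i j else 0)
          + (if M < cmod (\<alpha> d (i div s)) then 0 else \<alpha> d (i div s)) * ?o i j * 1
          = offd s t ns (\<lambda>i j. \<alpha> d (i div s) * F d i j) i j"
        by (auto simp: offd_def)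
    qed
  qed
  then show "\<exists>D. \<forall>d\<ge>D. \<forall>ns. length ns = \<nu> \<longrightarrow> sum_list ns = d \<longrightarrow>
     splits (d * s) (d * t) (\<epsilon> * real d) \<epsilon> (offd s t ns (\<lambda>i j. \<alpha> d (i div s) * F d i j))"
    by blast
qed

lemma negligible_offd_cmult:
  assumes "negligible_offd \<nu> s t F"
  shows "negligible_offd \<nu> s t (\<lambda>d i j. c * F d i j)"
proof (rule negligible_offd_row_mult[OF assms])
  fix \<epsilon> :: real assume "\<epsilon> > 0"
  then show "\<exists>M D. \<forall>d\<ge>D. real (card {i. i < d \<and> M < cmod c}) \<le> \<epsilon> * real d"
    by (intro exI[of _ "cmod c"]) simp
qed

text \<open>The embedding commutes with \<open>offd\<close>, because the block of an entry depends
  only on the quotients \<open>i div s\<close> and \<open>j div t\<close>.\<close>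

lemma negligible_offd_embed:
  assumes "negligible_offd \<nu> 1 1 F" "a < s" "b < t"
  shows "negligible_offd \<nu> s t
    (\<lambda>d i j. if i mod s = a \<and> j mod t = b then F d (i div s) (j div t) else 0)"
  unfolding negligible_offd_def
proof (intro allI impI)
  fix \<epsilon> :: real assume \<epsilon>: "\<epsilon> > 0"
  then obtain D where D: "\<And>d ns. d \<ge> D \<Longrightarrow> length ns = \<nu> \<Longrightarrow> sum_list ns = d \<Longrightarrow>
     splits d d (\<epsilon> * real d) \<epsilon> (offd 1 1 ns (F d))"
    using assms(1) unfolding negligible_offd_def by (metis mult.right_neutral)
  show "\<exists>D. \<forall>d\<ge>D. \<forall>ns. length ns = \<nu> \<longrightarrow> sum_list ns = d \<longrightarrow>
     splits (d * s) (d * t) (\<epsilon> * real d) \<epsilon>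
       (offd s t ns (\<lambda>i j. if i mod s = a \<and> j mod t = b then F d (i div s) (j div t) else 0))"
    by (intro exI[of _ D] allI impI, rule splits_cong[OF splits_embed[OF D]])
      (use assms \<epsilon> in \<open>auto simp: offd_def\<close>)
qed

lemma negligible_offd_toeplitz_nonneg:
  assumes h: "integrable (lebesgue_on {-pi..pi}) h" and h0: "\<And>\<theta>. 0 \<le> h \<theta>"
  shows "negligible_offd \<nu> 1 1 (\<lambda>d i j. fcoeff (\<lambda>\<theta>. of_real (h \<theta>)) (int i - int j))"
  unfolding negligible_offd_def
proof (intro allI impI)
  fix \<epsilon> :: real assume \<epsilon>: "\<epsilon> > 0"
  \<comment> \<open>N is the cost of cutting after the split. An integral below w^2 gives the
    Toeplitz matrix of the remainder rank at most w d and norm w; after the cut both are multiplied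
    by N, and N w = \<epsilon> / 2.\<close>
  define N where "N = real \<nu> + 1"
  have N: "N > 0" by (simp add: N_def)
  define w where "w = \<epsilon> / (2 * N)"
  have w: "w > 0" using \<epsilon> N by (simp add: w_def)
  obtain m where m: "(LINT \<theta>|lebesgue_on {-pi..pi}. h \<theta> - min (h \<theta>) (real m)) < w * w"
    using truncation_small[OF h, of "w * w"] h0 w by auto
  define h1 h2 where "h1 \<theta> = min (h \<theta>) (real m)" and "h2 \<theta> = h \<theta> - min (h \<theta>) (real m)" for \<theta>
  have int: "integrable (lebesgue_on {-pi..pi}) h1" "integrable (lebesgue_on {-pi..pi}) h2"
    using h by (simp_all add: h1_def[abs_def] h2_def[abs_def])
  have split: "fcoeff (\<lambda>\<theta>. of_real (h \<theta>)) k
      = fcoeff (\<lambda>\<theta>. of_real (h1 \<theta>)) k + fcoeff (\<lambda>\<theta>. of_real (h2 \<theta>)) k" for k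
  proof -
    have "(\<lambda>\<theta>. complex_of_real (h \<theta>)) = (\<lambda>\<theta>. of_real (h1 \<theta>) + of_real (h2 \<theta>))"
      by (simp add: h1_def h2_def)
    then show ?thesis using int by (simp add: fcoeff_add)
  qed
  have sm: "summable (\<lambda>l. (cmod (fcoeff (\<lambda>\<theta>. of_real (h1 \<theta>)) (int l)))\<^sup>2)"
    by (rule summable_fcoeff_square[OF int(1), of "real m"]) (auto simp: h1_def h0)
  \<comment> \<open>The Frobenius splitting at level \<epsilon> / 2 divides by (\<epsilon> / 2)^2,
    which leaves \<epsilon> / 2 d for the rank.\<close>
  define \<epsilon>' where "\<epsilon>' = (\<epsilon> / 2) * (\<epsilon> / 2)\<^sup>2"
  obtain D where D: "\<And>d ns. d \<ge> D \<Longrightarrow> length ns = \<nu> \<Longrightarrow>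
    (\<Sum>i<d. \<Sum>j<d. (cmod (offd 1 1 ns (\<lambda>i j. fcoeff (\<lambda>\<theta>. of_real (h1 \<theta>)) (int i - int j)) i j))\<^sup>2) \<le> \<epsilon>' * real d"
    by (rule offd_frobenius_small[OF _ sm, of \<epsilon>' \<nu>]) (use \<epsilon> in \<open>auto simp: fcoeff_cnj \<epsilon>'_def\<close>)
  have "splits d d (\<epsilon> * real d) \<epsilon> (offd 1 1 ns (\<lambda>i j. fcoeff (\<lambda>\<theta>. of_real (h \<theta>)) (int i - int j)))"
    if d: "d \<ge> D" and ns: "length ns = \<nu>" "sum_list ns = d" for d ns
  proof -
    have 1: "splits d d (\<epsilon> / 2 * real d) (\<epsilon> / 2) (offd 1 1 ns (\<lambda>i j. fcoeff (\<lambda>\<theta>. of_real (h1 \<theta>)) (int i - int j)))"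
    proof (rule splits_mono[OF splits_frobenius])
      show "\<epsilon> / 2 > 0" using \<epsilon> by simp
      show "(\<Sum>i<d. \<Sum>j<d. (cmod (offd 1 1 ns (\<lambda>i j. fcoeff (\<lambda>\<theta>. of_real (h1 \<theta>)) (int i - int j)) i j))\<^sup>2)
        / (\<epsilon> / 2)\<^sup>2 \<le> \<epsilon> / 2 * real d"
        using D[OF d ns(1)] \<epsilon> by (simp add: \<epsilon>'_def pos_divide_le_eq mult_ac)
    qed simp
    have "splits d d (w * real d) w (\<lambda>i j. fcoeff (\<lambda>\<theta>. of_real (h2 \<theta>)) (int i - int j))"
    proof (rule splits_mono[OF splits_toeplitz[OF int(2) _ w]])
      have "real d * (LINT \<theta>|lebesgue_on {-pi..pi}. h2 \<theta>) \<le> real d * (w * w)"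
        using m by (intro mult_left_mono) (auto simp: h2_def)
      then show "real d * (LINT \<theta>|lebesgue_on {-pi..pi}. h2 \<theta>) / w \<le> w * real d"
        using w by (simp add: pos_divide_le_eq mult_ac)
    qed (auto simp: h2_def)
    then have "splits (d * 1) (d * 1) (w * real d) w (\<lambda>i j. fcoeff (\<lambda>\<theta>. of_real (h2 \<theta>)) (int i - int j))"
      by simp
    from splits_offd[OF this _ ns(2)] w ns(1)
    have 2: "splits d d (N * (w * real d)) (N * w) (offd 1 1 ns (\<lambda>i j. fcoeff (\<lambda>\<theta>. of_real (h2 \<theta>)) (int i - int j)))"
      by (simp add: N_def)
    have Nw: "N * w = \<epsilon> / 2" using N by (simp add: w_def)
    show ?thesis
    proof (rule splits_cong[OF splits_mono[OF splits_add[OF 1 2]]])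
      show "\<epsilon> / 2 * real d + N * (w * real d) \<le> \<epsilon> * real d"
      proof -
        have e: "N * (w * real d) = \<epsilon> / 2 * real d" by (simp only: mult.assoc[symmetric] Nw)
        show ?thesis unfolding e by simp
      qed
    qed (use Nw in \<open>auto simp: offd_def split\<close>)
  qed
  then show "\<exists>D. \<forall>d\<ge>D. \<forall>ns. length ns = \<nu> \<longrightarrow> sum_list ns = d \<longrightarrow> splits (d * 1) (d * 1) (\<epsilon> * real d) \<epsilon>
      (offd 1 1 ns (\<lambda>i j. fcoeff (\<lambda>\<theta>. of_real (h \<theta>)) (int i - int j)))"
    by auto
qed

text \<open>Positive and negative parts of the real and imaginary parts supply the four nonnegative
  symbols that the definiteness argument requires.\<close>

lemma negligible_offd_toeplitz:
  assumes f: "integrable (lebesgue_on {-pi..pi}) f"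
  shows "negligible_offd \<nu> 1 1 (\<lambda>d i j. fcoeff f (int i - int j))"
proof -
  define h1 h2 h3 h4 where "h1 \<theta> = max 0 (Re (f \<theta>))" and "h2 \<theta> = max 0 (- Re (f \<theta>))"
    and "h3 \<theta> = max 0 (Im (f \<theta>))" and "h4 \<theta> = max 0 (- Im (f \<theta>))" for \<theta>
  note defs = h1_def h2_def h3_def h4_def
  let ?c = "\<lambda>h. fcoeff (\<lambda>\<theta>. complex_of_real (h \<theta>))"
  have int: "integrable (lebesgue_on {-pi..pi}) h1" "integrable (lebesgue_on {-pi..pi}) h2"
    "integrable (lebesgue_on {-pi..pi}) h3" "integrable (lebesgue_on {-pi..pi}) h4"
    unfolding defs[abs_def] using f by (auto intro!: integrable_max)
  have "f = (\<lambda>\<theta>. (of_real (h1 \<theta>) + (- 1) * of_real (h2 \<theta>)) + (\<i> * of_real (h3 \<theta>) + (- \<i>) * of_real (h4 \<theta>)))"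
    by (auto simp: defs complex_eq_iff max_def)
  then have "fcoeff f k = fcoeff (\<lambda>\<theta>. (of_real (h1 \<theta>) + (- 1) * of_real (h2 \<theta>))
      + (\<i> * of_real (h3 \<theta>) + (- \<i>) * of_real (h4 \<theta>))) k" for k by simp
  also have "\<dots> k = ?c h1 k + (- 1) * ?c h2 k + (\<i> * ?c h3 k + (- \<i>) * ?c h4 k)" for k
    using int by (subst fcoeff_add, (auto)[2])+ (simp only: fcoeff_cmult)
  finally have *: "fcoeff f k = ?c h1 k + (- 1) * ?c h2 k + (\<i> * ?c h3 k + (- \<i>) * ?c h4 k)" for k .
  show ?thesis
    unfolding *
    by (intro negligible_offd_add negligible_offd_cmult negligible_offd_toeplitz_nonneg int)
      (simp_all add: defs)
qed

section \<open>Samples of almost everywhere continuous functions\<close>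

text \<open>A sample point in C owns the open interval of length 1 / d to its left. For large d
  these intervals lie in U, since C has a positive distance margin inside U, and they are disjoint,
  so their total length is at most the measure of U.\<close>

lemma card_samples_le_measure:
  assumes C: "compact C" "C \<subseteq> U" and U: "open U" "U \<in> lmeasurable"
  obtains D where "\<And>d. d \<ge> D \<Longrightarrow>
    real (card {i. i < d \<and> real (i + 1) / real d \<in> C}) \<le> measure lebesgue U * real d"
proof -
  obtain \<rho> where \<rho>: "\<rho> > 0" "(\<Union>x\<in>C. ball x \<rho>) \<subseteq> U"
    using compact_subset_open_imp_ball_epsilon_subset[OF C(1) U(1) C(2)] by blast
  define D where "D = nat \<lceil>1 / \<rho>\<rceil> + 1"
  show ?thesis
  proof (rule that[of D])
    fix d assume "d \<ge> D"
    then have d: "d > 0" "1 / \<rho> \<le> real d" unfolding D_def by linarith+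
    then have d\<rho>: "1 / real d \<le> \<rho>" using \<rho>(1) by (simp add: field_simps)
    define T where "T = {i. i < d \<and> real (i + 1) / real d \<in> C}"
    define J where "J i = {real i / real d<..<real (i + 1) / real d}" for i
    have finT: "finite T" by (simp add: T_def)
    have mJ: "measure lebesgue (J i) = 1 / real d" for i
      using d by (simp add: J_def divide_right_mono diff_divide_distrib[symmetric])
    have "J i \<subseteq> U" if "i \<in> T" for i
    proof -
      have "J i \<subseteq> ball (real (i + 1) / real d) \<rho>"
      proof
        fix x assume "x \<in> J i"
        then have x: "real i / real d < x" "x < real (i + 1) / real d" by (auto simp: J_def)
        have "real (i + 1) / real d - real i / real d = 1 / real d"
          by (simp add: diff_divide_distrib[symmetric])
        then show "x \<in> ball (real (i + 1) / real d) \<rho>" using x d\<rho> by (simp add: dist_real_def)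
      qed
      then show ?thesis using \<rho>(2) that by (auto simp: T_def)
    qed
    then have sub: "(\<Union>i\<in>T. J i) \<subseteq> U" by blast
    have "pairwise (\<lambda>i j. disjnt (J i) (J j)) T"
    proof (rule pairwiseI)
      have "disjnt (J i) (J j)" if "i < j" for i j
      proof -
        have "real (i + 1) / real d \<le> real j / real d" using that by (intro divide_right_mono) auto
        then show ?thesis by (auto simp: disjnt_def J_def)
      qed
      then show "disjnt (J i) (J j)" if "i \<noteq> j" for i j
        using that by (metis disjnt_sym nat_neq_iff)
    qed
    then have "measure lebesgue (\<Union>i\<in>T. J i) = (\<Sum>i\<in>T. measure lebesgue (J i))"
      by (intro measure_UNION' finT) (auto simp: J_def)
    also have "\<dots> = real (card T) / real d" by (simp add: mJ)
    finally have "real (card T) / real d = measure lebesgue (\<Union>i\<in>T. J i)" by simp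
    also have "\<dots> \<le> measure lebesgue U"
      using finT by (intro measure_mono_fmeasurable sub U(2)) (auto simp: J_def)
    finally show "real (card T) \<le> measure lebesgue U * real d"
      using d by (simp add: pos_divide_le_eq)
  qed
qed

text \<open>A function continuous almost everywhere may be unbounded, but only near its
  discontinuities. These lie in an open set U of measure at most \<epsilon>; off U, continuity gives
  local bounds, and compactness reduces them to a single M.\<close>

lemma few_large_samples:
  fixes a :: "real \<Rightarrow> complex"
  assumes cont: "AE x in lebesgue_on {0..1}. continuous (at x within {0..1}) a" and "\<epsilon> > 0"
  shows "\<exists>M D. \<forall>d\<ge>D. real (card {i. i < d \<and> M < cmod (a (real (i + 1) / real d))}) \<le> \<epsilon> * real d"
proof -
  obtain N where N: "{x \<in> {0..1}. \<not> continuous (at x within {0..1}) a} \<subseteq> N"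
      "N \<in> null_sets (lebesgue_on {0..1})"
    using cont unfolding eventually_ae_filter by (auto simp: space_restrict_space)
  then have null: "N \<in> null_sets lebesgue" by (simp add: null_sets_restrict_space)
  then obtain U where U: "open U" "N \<subseteq> U" "U - N \<in> lmeasurable" "emeasure lebesgue (U - N) < ennreal \<epsilon>"
    using sets_lebesgue_outer_open[OF null_setsD2[OF null] \<open>\<epsilon> > 0\<close>] by blast
  have "N \<in> lmeasurable" using null by (auto simp: null_sets_def fmeasurable_def)
  then have Um: "U \<in> lmeasurable"
    using fmeasurable.Un[OF U(3), of N] U(2) by (simp add: Un_absorb2)
  have "measure lebesgue U = measure lebesgue (U - N)"
    using measure_Diff_null_set[OF _ null, of U] Um by (auto simp: fmeasurable_def)
  moreover have "measure lebesgue (U - N) \<le> \<epsilon>"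
    using U(3,4) \<open>\<epsilon> > 0\<close> by (simp add: emeasure_eq_measure2 ennreal_less_iff)
  ultimately have mU: "measure lebesgue U \<le> \<epsilon>" by simp
  have "\<exists>\<delta>>0. \<forall>y\<in>{0..1}. dist y x < \<delta> \<longrightarrow> dist (a y) (a x) < 1" if "x \<in> {0..1} - U" for x
  proof -
    have "continuous (at x within {0..1}) a" using that N(1) U(2) by auto
    then show ?thesis unfolding continuous_within_eps_delta by (elim allE[of _ 1]) simp
  qed
  then obtain \<delta> where \<delta>: "\<And>x. x \<in> {0..1} - U \<Longrightarrow> \<delta> x > 0"
      "\<And>x y. x \<in> {0..1} - U \<Longrightarrow> y \<in> {0..1} \<Longrightarrow> dist y x < \<delta> x \<Longrightarrow> dist (a y) (a x) < 1"
    by metis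
  have "compact ({0..1} - U)" using U(1) by (simp add: compact_diff)
  moreover have "{0..1} - U \<subseteq> (\<Union>x\<in>{0..1} - U. ball x (\<delta> x))" using \<delta>(1) by fastforce
  moreover have "\<And>x. x \<in> {0..1} - U \<Longrightarrow> open (ball x (\<delta> x))" by simp
  ultimately obtain F where F: "F \<subseteq> {0..1} - U" "finite F" "{0..1} - U \<subseteq> (\<Union>x\<in>F. ball x (\<delta> x))"
    by (metis (no_types, lifting) compactE_image)
  \<comment> \<open>A sum rather than a maximum, so that an empty F causes no exception.\<close>
  define M where "M = (\<Sum>x\<in>F. cmod (a x) + 1)"
  \<comment> \<open>Removing the finitely many balls leaves a compact subset of U, as the counting
    of samples requires; U intersected with the unit interval need not be compact.\<close>
  define C where "C = {0..1} - (\<Union>x\<in>F. ball x (\<delta> x))"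
  have "compact C" unfolding C_def by (intro compact_diff) auto
  moreover have "C \<subseteq> U" using F(3) by (auto simp: C_def)
  ultimately obtain D where D: "\<And>d. d \<ge> D \<Longrightarrow>
    real (card {i. i < d \<and> real (i + 1) / real d \<in> C}) \<le> measure lebesgue U * real d"
    using card_samples_le_measure U(1) Um by blast
  have bd: "cmod (a y) \<le> M" if y: "y \<in> {0..1}" "y \<notin> C" for y
  proof -
    obtain x where x: "x \<in> F" "dist y x < \<delta> x" using y by (auto simp: C_def dist_commute)
    then have "dist (a y) (a x) < 1" using \<delta>(2) F(1) y(1) by blast
    then have "cmod (a y) \<le> cmod (a x) + 1"
      using norm_triangle_sub[of "a y" "a x"] by (simp add: dist_norm)
    also have "\<dots> \<le> M" unfolding M_def using F(2) x(1) by (intro member_le_sum) auto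
    finally show ?thesis .
  qed
  have "real (card {i. i < d \<and> M < cmod (a (real (i + 1) / real d))}) \<le> \<epsilon> * real d" if "d \<ge> D" for d
  proof -
    have "card {i. i < d \<and> M < cmod (a (real (i + 1) / real d))}
        \<le> card {i. i < d \<and> real (i + 1) / real d \<in> C}"
    proof (intro card_mono, simp, safe)
      fix i assume i: "i < d" "M < cmod (a (real (i + 1) / real d))"
      have "real (i + 1) / real d \<in> {0..1}" using i(1) by simp
      then show "real (i + 1) / real d \<in> C" using bd i(2) by (meson not_le)
    qed
    then have "real (card {i. i < d \<and> M < cmod (a (real (i + 1) / real d))}) \<le> measure lebesgue U * real d"
      using D[OF that] by linarith
    also have "\<dots> \<le> \<epsilon> * real d" by (intro mult_right_mono mU) simp
    finally show ?thesis .
  qed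
  then show ?thesis by blast
qed

section \<open>Rank and operator norm of matrices\<close>

text \<open>A maximal independent set of columns has as many members as the rank, and by maximality
  it spans all columns; its members and the coefficients of the columns are the two factors.\<close>

lemma rank_le_mat_rank:
  assumes A: "A \<in> carrier_mat p q"
  shows "rank_le p q (mat_rank A) (\<lambda>i j. A $$ (i, j))"
proof -
  interpret vec_space "TYPE(complex)" p .
  have cols: "set (cols A) \<subseteq> carrier_vec p" using cols_dim A by blast
  obtain U where U: "finite U" "maximal U (\<lambda>T. T \<subseteq> set (cols A) \<and> lin_indpt T)"
    using maximal_exists_superset[of "set (cols A)" "\<lambda>T. T \<subseteq> set (cols A) \<and> lin_indpt T" "{}"]
      finite_lin_indpt2[of "{}"] by (auto simp: lin_dep_def)
  have card: "mat_rank A = card U"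
    using rank_card_indpt[OF A U(2)] A by (simp add: mat_rank_def)
  have indpt: "U \<subseteq> set (cols A)" "lin_indpt U" using U(2) by (auto simp: maximal_def)
  then have Uc: "U \<subseteq> carrier_vec p" using cols by blast
  have "x \<in> span U" if x: "x \<in> set (cols A)" for x
  proof (cases "x \<in> U")
    case True
    then show ?thesis using Uc in_own_span by auto
  next
    case False
    then have "lin_dep (U \<union> {x})" using U(2) x indpt by (auto simp: maximal_def)
    then show ?thesis using lin_dep_iff_in_span[of U x] Uc indpt False cols x by auto
  qed
  then have "\<exists>a. lincomb a U = x" if "x \<in> set (cols A)" for x
    using finite_in_span[OF U(1), of x] Uc that by auto
  then obtain a where a: "\<And>x. x \<in> set (cols A) \<Longrightarrow> lincomb (a x) U = x" by metis
  obtain g where g: "bij_betw g {..<card U} U"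
    using ex_bij_betw_nat_finite[OF U(1)] by (auto simp: atLeast0LessThan)
  have "A $$ (i, j) = (\<Sum>k<card U. g k $ i * a (col A j) (g k))" if "i < p" "j < q" for i j
  proof -
    have "col A j \<in> set (cols A)" using that A by (auto simp: cols_def)
    then have "A $$ (i, j) = lincomb (a (col A j)) U $ i" using a that A by simp
    also have "\<dots> = (\<Sum>x\<in>U. a (col A j) x * x $ i)" by (rule lincomb_index[OF that(1) Uc])
    also have "\<dots> = (\<Sum>k<card U. a (col A j) (g k) * g k $ i)"
      by (rule sum.reindex_bij_betw[OF g, symmetric])
    finally show ?thesis by (simp add: mult.commute)
  qed
  then have "\<forall>i<p. \<forall>j<q. A $$ (i, j) = (\<Sum>k<card U. g k $ i * a (col A j) (g k))" by simp
  then show ?thesis unfolding rank_le_def card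
    by (rule exI[of _ "\<lambda>k i. g k $ i", OF exI[of _ "\<lambda>k j. a (col A j) (g k)"]])
qed

lemma mat_rank_le:
  assumes "A \<in> carrier_mat p q" "rank_le p q r (\<lambda>i j. A $$ (i, j))"
  shows "mat_rank A \<le> r"
proof -
  interpret vec_space "TYPE(complex)" p .
  obtain u v where uv: "\<And>i j. i < p \<Longrightarrow> j < q \<Longrightarrow> A $$ (i, j) = (\<Sum>k<r. u k i * v k j)"
    using assms(2) unfolding rank_le_def by blast
  have "rank (mat p q (\<lambda>(i, j). \<Sum>k<r. u k i * v k j)) \<le> r"
  proof (induction r)
    case 0
    have "mat p q (\<lambda>(i, j). \<Sum>k<0. u k i * v k j) = 0\<^sub>m p q" by (intro eq_matI) auto
    then show ?case by (simp only: rank_0I)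
  next
    case (Suc r)
    let ?A = "\<lambda>r. mat p q (\<lambda>(i, j). \<Sum>k<r. u k i * v k j)"
    let ?B = "mat p q (\<lambda>(i, j). u r i * v r j)"
    have "?A (Suc r) = ?A r + ?B" by (intro eq_matI) auto
    moreover have "rank (?A r + ?B) \<le> rank (?A r) + rank ?B"
      by (rule rank_subadditive) auto
    moreover have "rank ?B \<le> 1" by (rule rank_le_1_product_entries) auto
    ultimately show ?case using Suc by simp
  qed
  moreover have "A = mat p q (\<lambda>(i, j). \<Sum>k<r. u k i * v k j)"
    using assms(1) uv by (intro eq_matI) auto
  ultimately show ?thesis using assms(1) by (simp add: mat_rank_def)
qed

lemma vec_norm2_mult_mat_vec:
  assumes "A \<in> carrier_mat p q" "v \<in> carrier_vec q"
  shows "vec_norm2 (A *\<^sub>v v) = L2_set (\<lambda>i. cmod (\<Sum>j<q. A $$ (i, j) * v $ j)) {..<p}"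
  unfolding vec_norm2_def
  by (rule L2_set_cong) (use assms in \<open>auto simp: scalar_prod_def lessThan_atLeast0\<close>)

text \<open>A crude bound by the sum of all entries, needed only to know that the supremum in
  \<open>op_norm\<close> is taken over a bounded set.\<close>

lemma norm_le_exists: "\<exists>w. norm_le p q w F"
proof -
  have "L2_set (\<lambda>i. cmod (\<Sum>j<q. F i j * v j)) {..<p}
      \<le> (\<Sum>i<p. \<Sum>j<q. cmod (F i j)) * L2_set (\<lambda>j. cmod (v j)) {..<q}" for v
  proof -
    have "L2_set (\<lambda>i. cmod (\<Sum>j<q. F i j * v j)) {..<p} \<le> (\<Sum>i<p. cmod (\<Sum>j<q. F i j * v j))"
      by (rule L2_set_le_sum) simp
    also have "\<dots> \<le> (\<Sum>i<p. \<Sum>j<q. cmod (F i j) * cmod (v j))"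
      by (intro sum_mono order_trans[OF norm_sum]) (simp add: norm_mult)
    also have "\<dots> \<le> (\<Sum>i<p. \<Sum>j<q. cmod (F i j) * L2_set (\<lambda>j. cmod (v j)) {..<q})"
      by (intro sum_mono mult_left_mono member_le_L2_set) auto
    finally show ?thesis by (simp add: sum_distrib_right)
  qed
  then show ?thesis unfolding norm_le_def by blast
qed

lemma op_norm_le:
  assumes A: "A \<in> carrier_mat p q" and "norm_le p q w (\<lambda>i j. A $$ (i, j))" "w \<ge> 0"
  shows "op_norm A \<le> w"
  unfolding op_norm_def
proof (rule cSUP_least)
  show "{v \<in> carrier_vec (dim_col A). vec_norm2 v \<le> 1} \<noteq> {}"
    by (auto intro!: exI[of _ "0\<^sub>v (dim_col A)"] simp: vec_norm2_def L2_set_def)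
  fix v assume "v \<in> {v \<in> carrier_vec (dim_col A). vec_norm2 v \<le> 1}"
  then have v: "v \<in> carrier_vec q" "vec_norm2 v \<le> 1" using A by auto
  have "vec_norm2 (A *\<^sub>v v) \<le> w * L2_set (\<lambda>j. cmod (v $ j)) {..<q}"
    unfolding vec_norm2_mult_mat_vec[OF A v(1)] by (rule norm_leD[OF assms(2)])
  also have "\<dots> = w * vec_norm2 v" using v(1) by (simp add: vec_norm2_def)
  also have "\<dots> \<le> w" using v(2) assms(3) by (simp add: mult_left_le)
  finally show "vec_norm2 (A *\<^sub>v v) \<le> w" .
qed

lemma vec_norm2_le_op_norm:
  assumes A: "A \<in> carrier_mat p q" and v: "v \<in> carrier_vec q" "vec_norm2 v \<le> 1"
  shows "vec_norm2 (A *\<^sub>v v) \<le> op_norm A"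
proof -
  obtain w where w: "norm_le p q w (\<lambda>i j. A $$ (i, j))" using norm_le_exists by blast
  have "vec_norm2 (A *\<^sub>v v) \<le> \<bar>w\<bar>" if v: "v \<in> carrier_vec q" "vec_norm2 v \<le> 1" for v
  proof -
    have "vec_norm2 (A *\<^sub>v v) \<le> w * L2_set (\<lambda>j. cmod (v $ j)) {..<q}"
      unfolding vec_norm2_mult_mat_vec[OF A v(1)] by (rule norm_leD[OF w])
    also have "\<dots> = w * vec_norm2 v" using v(1) by (simp add: vec_norm2_def)
    also have "\<dots> \<le> \<bar>w\<bar> * vec_norm2 v"
      by (intro mult_right_mono) (auto simp: vec_norm2_def)
    also have "\<dots> \<le> \<bar>w\<bar>" using v(2) by (simp add: mult_left_le)
    finally show ?thesis .
  qed
  then have "bdd_above ((\<lambda>v. vec_norm2 (A *\<^sub>v v)) ` {v \<in> carrier_vec (dim_col A). vec_norm2 v \<le> 1})"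
    using A by (intro bdd_aboveI[of _ "\<bar>w\<bar>"]) auto
  then show ?thesis unfolding op_norm_def by (rule cSUP_upper[rotated]) (use A v in auto)
qed

lemma op_norm_nonneg:
  assumes A: "A \<in> carrier_mat p q"
  shows "0 \<le> op_norm A"
proof -
  have "0 \<le> vec_norm2 (A *\<^sub>v 0\<^sub>v q)" by (simp add: vec_norm2_def)
  also have "\<dots> \<le> op_norm A"
    by (rule vec_norm2_le_op_norm[OF A]) (auto simp: vec_norm2_def L2_set_def)
  finally show ?thesis .
qed

lemma norm_le_op_norm:
  assumes A: "A \<in> carrier_mat p q"
  shows "norm_le p q (op_norm A) (\<lambda>i j. A $$ (i, j))"
proof (rule ccontr)
  assume "\<not> norm_le p q (op_norm A) (\<lambda>i j. A $$ (i, j))"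
  then obtain v where v: "(\<Sum>j<q. (cmod (v j))\<^sup>2) = 1"
      "op_norm A < L2_set (\<lambda>i. cmod (\<Sum>j<q. A $$ (i, j) * v j)) {..<p}"
    by (rule not_norm_leE)
  have "vec_norm2 (A *\<^sub>v vec q v) \<le> op_norm A"
    by (rule vec_norm2_le_op_norm[OF A]) (use v(1) in \<open>auto simp: vec_norm2_def L2_set_def\<close>)
  also have "vec_norm2 (A *\<^sub>v vec q v) = L2_set (\<lambda>i. cmod (\<Sum>j<q. A $$ (i, j) * v j)) {..<p}"
    by (subst vec_norm2_mult_mat_vec[OF A]) auto
  finally show False using v(2) by simp
qed

text \<open>Dictionary between \<open>splits\<close> and the decomposition in \<open>acs\<close>.
  One direction reads the given approximation, the other produces the new one.\<close>

lemma splits_mat_iff: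
  assumes X: "X \<in> carrier_mat p q" and B: "B \<in> carrier_mat p q" and "w \<ge> 0"
  shows "splits p q r w (\<lambda>i j. X $$ (i, j) - B $$ (i, j)) \<longleftrightarrow>
    (\<exists>R N. R \<in> carrier_mat p q \<and> N \<in> carrier_mat p q \<and> X = B + R + N \<and>
       real (mat_rank R) \<le> r \<and> op_norm N \<le> w)"
proof
  assume "splits p q r w (\<lambda>i j. X $$ (i, j) - B $$ (i, j))"
  then obtain k R where R: "real k \<le> r" "rank_le p q k R"
      "norm_le p q w (\<lambda>i j. X $$ (i, j) - B $$ (i, j) - R i j)"
    unfolding splits_def by blast
  define R' N' where "R' = mat p q (\<lambda>(i, j). R i j)"
    and "N' = mat p q (\<lambda>(i, j). X $$ (i, j) - B $$ (i, j) - R i j)"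
  have c: "R' \<in> carrier_mat p q" "N' \<in> carrier_mat p q" by (simp_all add: R'_def N'_def)
  have "mat_rank R' \<le> k"
    by (rule mat_rank_le[OF c(1)]) (use R(2) in \<open>auto simp: R'_def rank_le_def\<close>)
  then have r: "real (mat_rank R') \<le> r" using R(1) by linarith
  have w: "op_norm N' \<le> w"
    by (rule op_norm_le[OF c(2) norm_le_cong[OF R(3)]]) (auto simp: N'_def \<open>w \<ge> 0\<close>)
  have sum: "X = B + R' + N'"
    using X B by (intro eq_matI) (auto simp: R'_def N'_def)
  show "\<exists>R N. R \<in> carrier_mat p q \<and> N \<in> carrier_mat p q \<and> X = B + R + N \<and>
       real (mat_rank R) \<le> r \<and> op_norm N \<le> w"
    by (intro exI conjI) (fact c sum r w)+
next
  assume "\<exists>R N. R \<in> carrier_mat p q \<and> N \<in> carrier_mat p q \<and> X = B + R + N \<and>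
       real (mat_rank R) \<le> r \<and> op_norm N \<le> w"
  then obtain R N where RN: "R \<in> carrier_mat p q" "N \<in> carrier_mat p q" "X = B + R + N"
      "real (mat_rank R) \<le> r" "op_norm N \<le> w"
    by blast
  show "splits p q r w (\<lambda>i j. X $$ (i, j) - B $$ (i, j))"
    by (rule splitsI[OF RN(4) rank_le_mat_rank[OF RN(1)]],
        rule norm_le_cong[OF norm_le_mono[OF norm_le_op_norm[OF RN(2)] RN(5)]])
      (use RN B in auto)
qed

section \<open>Entries of the structured matrices\<close>

lemma diag_block_mat_Cons_index:
  assumes "A \<in> carrier_mat p q" "i < p + dim_row (diag_block_mat As)" "j < q + dim_col (diag_block_mat As)"
  shows "diag_block_mat (A # As) $$ (i, j) =
    (if i < p \<and> j < q then A $$ (i, j)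
     else if p \<le> i \<and> q \<le> j then diag_block_mat As $$ (i - p, j - q) else 0)"
  using assms by (auto simp: Let_def)

text \<open>Removing the first part of the partition shifts all later block starts, so the induction
  over the list needs a free offset; \<open>blockdiag\<close> is the case of offset 0.\<close>

lemma blockdiag_shift:
  fixes A :: "complex mat" and s t :: nat
  defines "B \<equiv> \<lambda>off ns. diag_block_mat (map (\<lambda>k. mat (ns ! k * s) (ns ! k * t)
      (\<lambda>(i, j). A $$ ((off + sum_list (take k ns)) * s + i, (off + sum_list (take k ns)) * t + j)))
      [0..<length ns])"
  shows "dim_row (B off ns) = sum_list ns * s" "dim_col (B off ns) = sum_list ns * t"
    "i < sum_list ns * s \<Longrightarrow> j < sum_list ns * t \<Longrightarrow> B off ns $$ (i, j) =
      (if blk ns (i div s) = blk ns (j div t) then A $$ (off * s + i, off * t + j) else 0)"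
proof -
  have Cons: "B off (n # ns) = diag_block_mat (mat (n * s) (n * t) (\<lambda>(i, j). A $$ (off * s + i, off * t + j))
      # map (\<lambda>k. mat (ns ! k * s) (ns ! k * t) (\<lambda>(i, j).
        A $$ ((off + n + sum_list (take k ns)) * s + i, (off + n + sum_list (take k ns)) * t + j))) [0..<length ns])"
    for off n ns
    unfolding B_def
    by (simp add: upt_conv_Cons map_Suc_upt[symmetric] add_ac o_def del: upt_Suc diag_block_mat.simps)
  have dims: "dim_row (B off ns) = sum_list ns * s \<and> dim_col (B off ns) = sum_list ns * t" for off ns
  proof (induction ns arbitrary: off)
    case Nil
    show ?case by (simp add: B_def)
  next
    case (Cons n ns)
    show ?case
      using Cons.IH[of "off + n"] unfolding \<open>B off (n # ns) = _\<close>
      by (simp add: dim_diag_block_mat B_def add_mult_distrib)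
  qed
  then show "dim_row (B off ns) = sum_list ns * s" "dim_col (B off ns) = sum_list ns * t" by auto
  show "i < sum_list ns * s \<Longrightarrow> j < sum_list ns * t \<Longrightarrow> B off ns $$ (i, j) =
      (if blk ns (i div s) = blk ns (j div t) then A $$ (off * s + i, off * t + j) else 0)"
  proof (induction ns arbitrary: off i j)
    case (Cons n ns)
    have st: "s > 0" "t > 0" using Cons.prems by (auto intro: Nat.gr0I)
    have C: "B off (n # ns) = diag_block_mat (mat (n * s) (n * t) (\<lambda>(i, j). A $$ (off * s + i, off * t + j))
      # map (\<lambda>k. mat (ns ! k * s) (ns ! k * t) (\<lambda>(i, j).
        A $$ ((off + n + sum_list (take k ns)) * s + i, (off + n + sum_list (take k ns)) * t + j))) [0..<length ns])"
      by (rule \<open>\<And>off n ns. B off (n # ns) = _ off n ns\<close>)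
    have idx: "B off (n # ns) $$ (i, j) = (if i < n * s \<and> j < n * t then A $$ (off * s + i, off * t + j)
       else if n * s \<le> i \<and> n * t \<le> j then B (off + n) ns $$ (i - n * s, j - n * t) else 0)"
      unfolding C
      by (subst diag_block_mat_Cons_index[of _ "n * s" "n * t"])
        (use Cons.prems dims[of "off + n" ns] in \<open>auto simp: B_def add_mult_distrib\<close>)
    have div: "(x - n * y) div y = x div y - n" if "n * y \<le> x" "y > 0" for x y
    proof -
      obtain z where "x = n * y + z" using \<open>n * y \<le> x\<close> le_Suc_ex by blast
      then show ?thesis using \<open>y > 0\<close> by simp
    qed
    show ?case
    proof (cases "n * s \<le> i \<and> n * t \<le> j")
      case True
      have "B (off + n) ns $$ (i - n * s, j - n * t)
        = (if blk ns ((i - n * s) div s) = blk ns ((j - n * t) div t)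
           then A $$ ((off + n) * s + (i - n * s), (off + n) * t + (j - n * t)) else 0)"
        using Cons.prems True by (intro Cons.IH) (auto simp: add_mult_distrib)
      then show ?thesis
        unfolding idx using True st by (simp add: div div_less_iff_less_mult add_mult_distrib)
    next
      case False
      then show ?thesis unfolding idx using st by (auto simp: div_less_iff_less_mult not_less not_le)
    qed
  qed simp
qed

lemma blockdiag_carrier:
  "blockdiag s t ns A \<in> carrier_mat (sum_list ns * s) (sum_list ns * t)"
  using blockdiag_shift(1,2)[where off = 0 and ns = ns and A = A and s = s and t = t]
  unfolding blockdiag_def add_0 by (rule carrier_matI)

lemma blockdiag_index:
  "i < sum_list ns * s \<Longrightarrow> j < sum_list ns * t \<Longrightarrow> blockdiag s t ns A $$ (i, j) =
      (if blk ns (i div s) = blk ns (j div t) then A $$ (i, j) else 0)"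
  using blockdiag_shift(3)[where off = 0 and ns = ns and A = A and s = s and t = t and i = i and j = j]
  unfolding blockdiag_def add_0 mult_0 by blast

lemma diag_block_mat_uniform:
  assumes "\<And>x. x \<in> set xs \<Longrightarrow> g x \<in> carrier_mat s t"
  shows "diag_block_mat (map g xs) \<in> carrier_mat (length xs * s) (length xs * t)"
    "i < length xs * s \<Longrightarrow> j < length xs * t \<Longrightarrow> diag_block_mat (map g xs) $$ (i, j) =
      (if i div s = j div t then g (xs ! (i div s)) $$ (i mod s, j mod t) else 0)"
proof -
  have dims: "diag_block_mat (map g xs) \<in> carrier_mat (length xs * s) (length xs * t)"
    if "\<And>x. x \<in> set xs \<Longrightarrow> g x \<in> carrier_mat s t" for xs
    using that by (induction xs) (auto simp: Let_def)
  then show "diag_block_mat (map g xs) \<in> carrier_mat (length xs * s) (length xs * t)"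
    using assms by blast
  show "i < length xs * s \<Longrightarrow> j < length xs * t \<Longrightarrow> diag_block_mat (map g xs) $$ (i, j) =
      (if i div s = j div t then g (xs ! (i div s)) $$ (i mod s, j mod t) else 0)"
    using assms
  proof (induction xs arbitrary: i j)
    case (Cons x xs)
    have st: "s > 0" "t > 0" using Cons.prems by (auto intro: Nat.gr0I)
    have d: "diag_block_mat (map g xs) \<in> carrier_mat (length xs * s) (length xs * t)"
      using Cons.prems by (intro dims) auto
    have idx: "diag_block_mat (map g (x # xs)) $$ (i, j) = (if i < s \<and> j < t then g x $$ (i, j)
       else if s \<le> i \<and> t \<le> j then diag_block_mat (map g xs) $$ (i - s, j - t) else 0)"
      unfolding list.map using Cons.prems d by (intro diag_block_mat_Cons_index) auto
    show ?case
    proof (cases "s \<le> i \<and> t \<le> j")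
      case True
      have "diag_block_mat (map g xs) $$ (i - s, j - t) =
        (if (i - s) div s = (j - t) div t then g (xs ! ((i - s) div s)) $$ ((i - s) mod s, (j - t) mod t) else 0)"
        using Cons.prems True by (intro Cons.IH) auto
      moreover have "i div s = Suc ((i - s) div s)" "j div t = Suc ((j - t) div t)"
        using True st by (auto simp: le_div_geq)
      moreover have "(i - s) mod s = i mod s" "(j - t) mod t = j mod t"
        using True by (auto simp: le_mod_geq)
      ultimately show ?thesis unfolding idx using True by auto
    next
      case False
      have "i div s = 0 \<longleftrightarrow> i < s" "j div t = 0 \<longleftrightarrow> j < t" using st by (auto simp: div_eq_0_iff)
      then show ?thesis unfolding idx using False by (auto simp: not_le)
    qed
  qed simp
qed

text \<open>Left multiplication by the sampling matrix scales rows. Indices start at 0 while the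
  samples start at 1 / d, whence the + 1.\<close>

lemma diag_sampling_mult_index:
  assumes T: "T \<in> carrier_mat (d * s) q" and ij: "i < d * s" "j < q"
  shows "(diag_sampling d (\<lambda>x. a x \<cdot>\<^sub>m 1\<^sub>m s) * T) $$ (i, j) = a (real (i div s + 1) / real d) * T $$ (i, j)"
proof -
  let ?D = "diag_sampling d (\<lambda>x. a x \<cdot>\<^sub>m 1\<^sub>m s)"
  have s: "s > 0" using ij by (auto intro: Nat.gr0I)
  have D: "?D \<in> carrier_mat (d * s) (d * s)"
    using diag_block_mat_uniform(1)[of "[1..<Suc d]" "\<lambda>i. a (real i / real d) \<cdot>\<^sub>m 1\<^sub>m s" s s]
    by (simp add: diag_sampling_def del: upt_Suc)
  have ent: "?D $$ (i, k) = (if k = i then a (real (i div s + 1) / real d) else 0)" if "k < d * s" for k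
  proof -
    have "?D $$ (i, k) = (if i div s = k div s
        then (a (real ([1..<Suc d] ! (i div s)) / real d) \<cdot>\<^sub>m 1\<^sub>m s) $$ (i mod s, k mod s) else 0)"
      unfolding diag_sampling_def using that ij
      by (intro diag_block_mat_uniform(2)) (simp_all del: upt_Suc)
    moreover have "[1..<Suc d] ! (i div s) = i div s + 1"
      using less_mult_imp_div_less[OF ij(1)] by (simp del: upt_Suc)
    moreover have "k = i \<longleftrightarrow> i div s = k div s \<and> i mod s = k mod s"
      by (metis div_mult_mod_eq)
    ultimately show ?thesis using s by auto
  qed
  have "(?D * T) $$ (i, j) = (\<Sum>k<d * s. ?D $$ (i, k) * T $$ (k, j))"
    using D T ij by (simp add: scalar_prod_def lessThan_atLeast0)
  also have "\<dots> = (\<Sum>k<d * s. if k = i then a (real (i div s + 1) / real d) * T $$ (i, j) else 0)"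
    by (intro sum.cong) (auto simp: ent)
  finally show ?thesis using ij by simp
qed

section \<open>Negligibility for block Toeplitz matrices and for the approximants of GLT
  sequences\<close>

lemma toeplitz_carrier: "toeplitz s t d f \<in> carrier_mat (d * s) (d * t)"
  by (simp add: toeplitz_def)

text \<open>A block Toeplitz matrix is the sum over (a, b) of the scalar Toeplitz matrices of the
  entries of f, each embedded at position (a, b) of every block.\<close>

lemma negligible_offd_block_toeplitz:
  assumes f: "mat_integrable s t (lebesgue_on {-pi..pi}) f"
  shows "negligible_offd \<nu> s t (\<lambda>d i j. toeplitz s t d f $$ (i, j))"
proof -
  let ?c = "\<lambda>a b. fcoeff (\<lambda>\<theta>. f \<theta> $$ (a, b))"
  let ?F = "\<lambda>a b d i j. if i mod s = a \<and> j mod t = b then ?c a b (int (i div s) - int (j div t)) else 0"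
  have "negligible_offd \<nu> s t (\<lambda>d i j. \<Sum>a<s. \<Sum>b<t. ?F a b d i j)"
  proof (intro negligible_offd_sum finite_lessThan)
    fix a b assume "a \<in> {..<s}" "b \<in> {..<t}"
    then have "integrable (lebesgue_on {-pi..pi}) (\<lambda>\<theta>. f \<theta> $$ (a, b))"
      using f by (simp add: mat_integrable_def)
    from negligible_offd_embed[OF negligible_offd_toeplitz[OF this], of a s b t]
    show "negligible_offd \<nu> s t (?F a b)" using \<open>a \<in> {..<s}\<close> \<open>b \<in> {..<t}\<close> by simp
  qed
  then show ?thesis
  proof (rule negligible_offd_cong)
    fix d i j assume ij: "i < d * s" "j < d * t"
    then have st: "i mod s < s" "j mod t < t" by (auto intro!: mod_less_divisor Nat.gr0I)
    have "(\<Sum>a<s. \<Sum>b<t. ?F a b d i j) = (\<Sum>a<s. if a = i mod s then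
        (\<Sum>b<t. if b = j mod t then ?c (i mod s) (j mod t) (int (i div s) - int (j div t)) else 0) else 0)"
      by (intro sum.cong refl) auto
    also have "\<dots> = ?c (i mod s) (j mod t) (int (i div s) - int (j div t))" using st by simp
    also have "\<dots> = toeplitz s t d f $$ (i, j)"
      using ij st by (simp add: toeplitz_def fourier_coeff_def fcoeff_def)
    finally show "(\<Sum>a<s. \<Sum>b<t. ?F a b d i j) = toeplitz s t d f $$ (i, j)" .
  qed
qed

lemma negligible_offd_glt_term:
  fixes I :: "'i set"
  assumes "finite I" "\<And>i. i \<in> I \<Longrightarrow> AE x in lebesgue_on {0..1}. continuous (at x within {0..1}) (a i)"
    "\<And>i. i \<in> I \<Longrightarrow> mat_integrable s t (lebesgue_on {-pi..pi}) (f i)"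
  shows "negligible_offd \<nu> s t (\<lambda>d i j. mat_sum (d * s) (d * t)
    (\<lambda>i. diag_sampling d (\<lambda>x. a i x \<cdot>\<^sub>m 1\<^sub>m s) * toeplitz s t d (f i)) I $$ (i, j))"
proof (rule negligible_offd_cong)
  show "negligible_offd \<nu> s t (\<lambda>d i j. \<Sum>k\<in>I. a k (real (i div s + 1) / real d) * toeplitz s t d (f k) $$ (i, j))"
    using assms
    by (intro negligible_offd_sum negligible_offd_row_mult[where \<alpha> = "\<lambda>d i. a _ (real (i + 1) / real d)"]
        negligible_offd_block_toeplitz few_large_samples) auto
qed (simp add: mat_sum_def diag_sampling_mult_index[OF toeplitz_carrier])

theorem theorem4p1:
  fixes S :: "nat set" and \<nu> s t :: nat and d :: "nat \<Rightarrow> nat" and ns :: "nat \<Rightarrow> nat list"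
    and \<kappa> :: "real \<times> real \<Rightarrow> complex mat" and A :: "nat \<Rightarrow> complex mat"
  assumes "infinite S"
    and "\<nu> \<ge> 1" and "s \<ge> 1" and "t \<ge> 1"
    and "\<forall>n\<in>S. d n > 0"
    and "filterlim d at_top (inf sequentially (principal S))"
    and "\<forall>n\<in>S. length (ns n) = \<nu> \<and> is_partition (ns n) (d n)"
    and "mat_measurable s t (lebesgue_on ({0..1} \<times> {-pi..pi})) \<kappa>"
    and "\<forall>n\<in>S. A n \<in> carrier_mat (d n * s) (d n * t)"
    and "glt S s t d A \<kappa>"
  shows "glt S s t d (\<lambda>n. blockdiag s t (ns n) (A n)) \<kappa>"
proof -
  obtain N :: "nat \<Rightarrow> nat" and a f where af: "\<And>m i. i \<in> {1..N m} \<Longrightarrow>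
        (AE x in lebesgue_on {0..1}. continuous (at x within {0..1}) (a i m))"
      "\<And>m i. i \<in> {1..N m} \<Longrightarrow> mat_integrable s t (lebesgue_on {-pi..pi}) (f i m)"
    and conv: "AE (x, \<theta>) in lebesgue_on ({0..1} \<times> {-pi..pi}). \<forall>j<s. \<forall>k<t.
           (\<lambda>m. mat_sum s t (\<lambda>i. a i m x \<cdot>\<^sub>m f i m \<theta>) {1..N m} $$ (j, k))
             \<longlonglongrightarrow> \<kappa> (x, \<theta>) $$ (j, k)"
    and acs: "acs S (\<lambda>n. d n * s) (\<lambda>n. d n * t)
          (\<lambda>n m. mat_sum (d n * s) (d n * t)
             (\<lambda>i. diag_sampling (d n) (\<lambda>x. a i m x \<cdot>\<^sub>m 1\<^sub>m s) * toeplitz s t (d n) (f i m))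
             {1..N m}) A"
    using assms(10) unfolding glt_def by blast
  define B where "B n m = mat_sum (d n * s) (d n * t)
             (\<lambda>i. diag_sampling (d n) (\<lambda>x. a i m x \<cdot>\<^sub>m 1\<^sub>m s) * toeplitz s t (d n) (f i m)) {1..N m}" for n m
  have Bc: "B n m \<in> carrier_mat (d n * s) (d n * t)" for n m by (simp add: B_def mat_sum_def)
  have ns: "length (ns n) = \<nu>" "sum_list (ns n) = d n" if "n \<in> S" for n
    using assms(7) that by (auto simp: is_partition_def)
  have bc: "blockdiag s t (ns n) (A n) \<in> carrier_mat (d n * s) (d n * t)" if "n \<in> S" for n
    using blockdiag_carrier[of s t "ns n" "A n"] ns[OF that] by simp
  obtain n0 c \<omega> where c: "c \<longlonglongrightarrow> 0" and \<omega>: "\<omega> \<longlonglongrightarrow> 0"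
    and dec: "\<And>m n. n \<in> S \<Longrightarrow> n0 m \<le> n \<Longrightarrow> \<exists>R N. R \<in> carrier_mat (d n * s) (d n * t) \<and>
         N \<in> carrier_mat (d n * s) (d n * t) \<and> A n = B n m + R + N \<and>
         real (mat_rank R) \<le> c m * real (min (d n * s) (d n * t)) \<and> op_norm N \<le> \<omega> m"
    using acs unfolding acs_def B_def[symmetric] by blast
  \<comment> \<open>Any positive null sequence would do: it is the budget granted to the part of the
    m-th approximant outside the blocks.\<close>
  define e where "e m = 1 / real (Suc m)" for m
  have e: "e m > 0" for m by (simp add: e_def)
  \<comment> \<open>For fixed m the approximant has a fixed finite number of terms; the threshold in
    d becomes one in n because d tends to infinity along S.\<close>
  have "\<exists>n1. \<forall>n\<in>S. n1 \<le> n \<longrightarrow>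
      splits (d n * s) (d n * t) (e m * real (d n)) (e m) (offd s t (ns n) (\<lambda>i j. B n m $$ (i, j)))" for m
  proof -
    have "negligible_offd \<nu> s t (\<lambda>d i j. mat_sum (d * s) (d * t)
      (\<lambda>i. diag_sampling d (\<lambda>x. a i m x \<cdot>\<^sub>m 1\<^sub>m s) * toeplitz s t d (f i m)) {1..N m} $$ (i, j))"
      by (rule negligible_offd_glt_term) (use af in auto)
    from this[unfolded negligible_offd_def, rule_format, OF e]
    obtain D where "\<forall>d\<ge>D. \<forall>ns. length ns = \<nu> \<longrightarrow> sum_list ns = d \<longrightarrow>
      splits (d * s) (d * t) (e m * real d) (e m) (offd s t ns (\<lambda>i j. mat_sum (d * s) (d * t)
        (\<lambda>i. diag_sampling d (\<lambda>x. a i m x \<cdot>\<^sub>m 1\<^sub>m s) * toeplitz s t d (f i m)) {1..N m} $$ (i, j)))"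
      by blast
    then have D: "splits (d n * s) (d n * t) (e m * real (d n)) (e m) (offd s t (ns n) (\<lambda>i j. B n m $$ (i, j)))"
      if "n \<in> S" "D \<le> d n" for n
      using ns[OF that(1)] that(2) unfolding B_def by blast
    have "\<forall>\<^sub>F n in inf sequentially (principal S). D \<le> d n"
      using assms(6) by (simp add: filterlim_at_top)
    then obtain n1 where "\<And>n. n1 \<le> n \<Longrightarrow> n \<in> S \<Longrightarrow> D \<le> d n"
      unfolding eventually_inf_principal eventually_sequentially by blast
    then show ?thesis using D by blast
  qed
  then obtain n1 where n1: "\<And>m n. n \<in> S \<Longrightarrow> n1 m \<le> n \<Longrightarrow>
      splits (d n * s) (d n * t) (e m * real (d n)) (e m) (offd s t (ns n) (\<lambda>i j. B n m $$ (i, j)))"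
    by metis
  have e0: "e \<longlonglongrightarrow> 0" unfolding e_def[abs_def] by (rule LIMSEQ_Suc[OF lim_1_over_n])
  define c' \<omega>' where "c' m = real \<nu> * c m + e m" and "\<omega>' m = real \<nu> * \<omega> m + e m" for m
  have lim: "c' \<longlonglongrightarrow> 0" "\<omega>' \<longlonglongrightarrow> 0"
    using tendsto_add[OF tendsto_mult_left[OF c, of "real \<nu>"] e0]
      tendsto_add[OF tendsto_mult_left[OF \<omega>, of "real \<nu>"] e0]
    by (simp_all add: c'_def[abs_def] \<omega>'_def[abs_def])
  have dec': "\<exists>R N. R \<in> carrier_mat (d n * s) (d n * t) \<and> N \<in> carrier_mat (d n * s) (d n * t) \<and>
         blockdiag s t (ns n) (A n) = B n m + R + N \<and>
         real (mat_rank R) \<le> c' m * real (min (d n * s) (d n * t)) \<and> op_norm N \<le> \<omega>' m"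
    if n: "n \<in> S" "max (n0 m) (n1 m) \<le> n" for m n
  proof -
    let ?k = "real (min (d n * s) (d n * t))"
    have An: "A n \<in> carrier_mat (d n * s) (d n * t)" using assms(9) n by blast
    \<comment> \<open>The definition of \<open>acs\<close> does not demand nonnegativity, but
      \<omega> m bounds an operator norm at this n.\<close>
    have \<omega>0: "\<omega> m \<ge> 0"
      using dec[of n m] n op_norm_nonneg by (meson max.boundedE order_trans)
    have "splits (d n * s) (d n * t) (c m * ?k) (\<omega> m) (\<lambda>i j. A n $$ (i, j) - B n m $$ (i, j))"
      using dec[of n m] n by (subst splits_mat_iff[OF An Bc \<omega>0]) auto
    from splits_block_diagonal[OF this \<omega>0 ns(2)[OF n(1)]]
    have 1: "splits (d n * s) (d n * t) (real \<nu> * (c m * ?k)) (real \<nu> * \<omega> m)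
      (\<lambda>i j. if blk (ns n) (i div s) = blk (ns n) (j div t) then A n $$ (i, j) - B n m $$ (i, j) else 0)"
      using ns(1)[OF n(1)] by simp
    have 2: "splits (d n * s) (d n * t) (e m * real (d n)) (1 * e m)
      (\<lambda>i j. - 1 * offd s t (ns n) (\<lambda>i j. B n m $$ (i, j)) i j * 1)"
      by (rule splits_mask[OF n1]) (use n e[of m] in auto)
    \<comment> \<open>The approximants B stay the same. Inside the blocks the difference is that of
      A and B, outside it is - B, so the budgets of the two splittings add up.\<close>
    have "splits (d n * s) (d n * t) (c' m * ?k) (\<omega>' m)
      (\<lambda>i j. blockdiag s t (ns n) (A n) $$ (i, j) - B n m $$ (i, j))"
    proof (rule splits_cong[OF splits_mono[OF splits_add[OF 1 2]]])
      \<comment> \<open>Negligibility measures rank against d, \<open>acs\<close> against the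
        smaller matrix dimension; s, t \<ge> 1 makes the former the stricter one.\<close>
      have "real (d n) \<le> ?k" using assms(3,4) by simp
      then have "e m * real (d n) \<le> e m * ?k" using e[of m] by (intro mult_left_mono) auto
      then show "real \<nu> * (c m * ?k) + e m * real (d n) \<le> c' m * ?k"
        by (simp add: c'_def algebra_simps)
    qed (auto simp: \<omega>'_def offd_def blockdiag_index ns[OF n(1)])
    moreover have "\<omega>' m \<ge> 0" using \<omega>0 e[of m] by (simp add: \<omega>'_def)
    ultimately show ?thesis using splits_mat_iff[OF bc[OF n(1)] Bc] by blast
  qed
  have "acs S (\<lambda>n. d n * s) (\<lambda>n. d n * t) B (\<lambda>n. blockdiag s t (ns n) (A n))"
    unfolding acs_def using bc Bc lim dec'
    by (intro conjI exI[of _ "\<lambda>m. max (n0 m) (n1 m)"] exI[of _ c'] exI[of _ \<omega>']) auto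
  then show ?thesis
    unfolding glt_def B_def[abs_def] using bc assms(8) af conv by blast
qed

end
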